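(* Let $\psi\in F^2$ and let $\varphi$ be an entire function such that the weighted composition operator $W_{\psi,\varphi}$ belongs to $\mathcal{T}$. Then $W_{\psi,\varphi}$ is either compact or a constant multiple of a Weyl operator $W_z$ for some $z\in\mathbb{C}$.
   Context: $\mu$ is the Gaussian measure $d\mu(z)=\frac1\pi e^{-|z|^2}dz$ on $\mathbb{C}$, and $F^2=L^2(\mathbb{C},\mu)\cap\operatorname{Hol}(\mathbb{C})$ is the Fock space. Let $P$ be the orthogonal projection of $L^2(\mathbb{C},\mu)$ onto $F^2$; for $f\in L^\infty(\mathbb{C})$ the Toeplitz operator is $T_f g=P(fg)$, $g\in F^2$. The Toeplitz algebra $\mathcal{T}\subset\mathcal{L}(F^2)$ is the $C^*$-algebra generated by all $T_f$, $f\in L^\infty(\mathbb{C})$. For $\psi\in F^2$ and $\varphi$ entire, the weighted composition operator is $W_{\psi,\varphi}f=\psi\cdot(f\circ\varphi)$; $W_{\psi,\varphi}\in\mathcal{T}$ means in particular that it is a bounded operator on $F^2$. For $z\in\mathbb{C}$ the Weyl operator $W_z$ on $F^2$ is $W_zf(w)=k_z(w)f(w-z)$, where $k_z(w)=e^{w\overline z-|z|^2/2}$. *)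

theory Defs
  imports "HOL-Complex_Analysis.Complex_Analysis"
begin

definition gauss :: "complex measure" where
  "gauss = density lborel (\<lambda>z. ennreal (exp (- (cmod z)\<^sup>2) / pi))"

definition square_integrable :: "(complex \<Rightarrow> complex) \<Rightarrow> bool" where
  "square_integrable f \<longleftrightarrow>
     f \<in> borel_measurable gauss \<and> integrable gauss (\<lambda>z. (cmod (f z))\<^sup>2)"

definition l2_inner :: "(complex \<Rightarrow> complex) \<Rightarrow> (complex \<Rightarrow> complex) \<Rightarrow> complex" where
  "l2_inner f g = (LINT z|gauss. f z * cnj (g z))"

definition fock_space :: "(complex \<Rightarrow> complex) set" where
  "fock_space = {f. f holomorphic_on UNIV \<and> square_integrable f}"

lemma sets_gauss [simp, measurable_cong]: "sets gauss = sets borel"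
  by (simp add: gauss_def)

lemma gauss_density_measurable [measurable]:
  "(\<lambda>z::complex. exp (- (cmod z)\<^sup>2) / pi) \<in> borel_measurable borel"
  by measurable

lemma entire_measurable: "f holomorphic_on UNIV \<Longrightarrow> f \<in> borel_measurable borel"
  by (simp add: borel_measurable_continuous_onI holomorphic_on_imp_continuous_on)

lemma square_integrable_add:
  assumes "square_integrable f" "square_integrable g"
  shows "square_integrable (\<lambda>z. f z + g z)"
proof -
  have [measurable]: "f \<in> borel_measurable gauss" "g \<in> borel_measurable gauss"
    using assms by (auto simp: square_integrable_def)
  have "integrable gauss (\<lambda>z. 2 * (cmod (f z))\<^sup>2 + 2 * (cmod (g z))\<^sup>2)"
    using assms by (auto simp: square_integrable_def)
  then have "integrable gauss (\<lambda>z. (cmod (f z + g z))\<^sup>2)"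
  proof (rule Bochner_Integration.integrable_bound)
    have "(cmod (f z + g z))\<^sup>2 \<le> 2 * (cmod (f z))\<^sup>2 + 2 * (cmod (g z))\<^sup>2" for z
    proof -
      have "(cmod (f z + g z))\<^sup>2 \<le> (cmod (f z) + cmod (g z))\<^sup>2"
        by (simp add: norm_triangle_ineq power_mono)
      also have "\<dots> \<le> 2 * (cmod (f z))\<^sup>2 + 2 * (cmod (g z))\<^sup>2"
        using zero_le_power2[of "cmod (f z) - cmod (g z)"]
        by (simp add: power2_sum power2_diff)
      finally show ?thesis .
    qed
    then show "AE z in gauss. norm ((cmod (f z + g z))\<^sup>2)
        \<le> norm (2 * (cmod (f z))\<^sup>2 + 2 * (cmod (g z))\<^sup>2)"
      by (intro AE_I2) (smt (verit) real_norm_def zero_le_power2)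
  qed measurable
  then show ?thesis
    by (simp add: square_integrable_def)
qed

lemma square_integrable_mult_const:
  assumes "square_integrable f"
  shows "square_integrable (\<lambda>z. c * f z)"
  using assms by (auto simp: square_integrable_def norm_mult power_mult_distrib)

lemma integrable_l2_inner:
  assumes "square_integrable f" "square_integrable g"
  shows "integrable gauss (\<lambda>z. f z * cnj (g z))"
proof -
  have [measurable]: "cnj \<in> borel_measurable borel"
    by (intro borel_measurable_continuous_onI continuous_intros)
  have [measurable]: "f \<in> borel_measurable gauss" "g \<in> borel_measurable gauss"
    using assms by (auto simp: square_integrable_def)
  have "integrable gauss (\<lambda>z. (cmod (f z))\<^sup>2 + (cmod (g z))\<^sup>2)"
    using assms by (auto simp: square_integrable_def)
  then show ?thesis
  proof (rule Bochner_Integration.integrable_bound)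
    have "cmod (f z) * cmod (g z) \<le> (cmod (f z))\<^sup>2 + (cmod (g z))\<^sup>2" for z
      using zero_le_power2[of "cmod (f z) - cmod (g z)"]
        mult_nonneg_nonneg[OF norm_ge_zero[of "f z"] norm_ge_zero[of "g z"]]
      unfolding power2_diff mult.assoc by linarith
    then show "AE z in gauss. norm (f z * cnj (g z)) \<le> norm ((cmod (f z))\<^sup>2 + (cmod (g z))\<^sup>2)"
      by (auto simp: norm_mult)
  qed measurable
qed

lemma fock_space_add: "f \<in> fock_space \<Longrightarrow> g \<in> fock_space \<Longrightarrow> (\<lambda>z. f z + g z) \<in> fock_space"
  by (auto simp: fock_space_def square_integrable_add intro: holomorphic_intros)

lemma fock_space_mult_const: "f \<in> fock_space \<Longrightarrow> (\<lambda>z. c * f z) \<in> fock_space"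
  by (auto simp: fock_space_def square_integrable_mult_const intro: holomorphic_intros)

lemma fock_space_zero: "(\<lambda>z. 0) \<in> fock_space"
  by (auto simp: fock_space_def square_integrable_def)

lemma AE_gauss_iff: "(AE z in gauss. P z) \<longleftrightarrow> (AE z in lborel. P z)"
  unfolding gauss_def
  by (subst AE_density) (auto simp: ennreal_eq_0_iff divide_le_0_iff not_le)

lemma l2_inner_self_eq_zero:
  assumes "f \<in> fock_space" "l2_inner f f = 0"
  shows "f z = 0"
proof -
  have hol: "f holomorphic_on UNIV" and int: "integrable gauss (\<lambda>z. (cmod (f z))\<^sup>2)"
    using assms by (auto simp: fock_space_def square_integrable_def)
  have "complex_of_real (LINT z|gauss. (cmod (f z))\<^sup>2) = 0"
    using assms(2) unfolding l2_inner_def complex_norm_square[symmetric]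
    by (simp del: of_real_power)
  then have "(LINT z|gauss. (cmod (f z))\<^sup>2) = 0"
    by simp
  then have "AE z in gauss. (cmod (f z))\<^sup>2 = 0"
    using int by (subst (asm) integral_nonneg_eq_0_iff_AE) auto
  then have "AE z in lborel. f z = 0"
    by (simp add: AE_gauss_iff)
  moreover have op: "open {z. f z \<noteq> 0}"
    using hol by (intro open_Collect_neq) (auto intro: holomorphic_on_imp_continuous_on)
  ultimately have "{z. f z \<noteq> 0} \<in> null_sets lborel"
    by (subst (asm) AE_iff_null) auto
  then have "negligible {z. f z \<noteq> 0}"
    using negligible_iff_null_sets null_sets_completionI by blast
  then have "{z. f z \<noteq> 0} = {}"
    using op open_not_negligible by blast
  then show ?thesis by auto
qed

typedef fock = fock_space
  morphisms apply_fock Abs_fock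
  using fock_space_zero by blast

setup_lifting type_definition_fock

instantiation fock :: real_vector
begin

lift_definition zero_fock :: fock is "\<lambda>z. 0" by (rule fock_space_zero)
lift_definition plus_fock :: "fock \<Rightarrow> fock \<Rightarrow> fock" is "\<lambda>f g z. f z + g z"
  by (rule fock_space_add)
lift_definition uminus_fock :: "fock \<Rightarrow> fock" is "\<lambda>f z. - f z"
  using fock_space_mult_const[of _ "-1"] by simp
lift_definition minus_fock :: "fock \<Rightarrow> fock \<Rightarrow> fock" is "\<lambda>f g z. f z - g z"
  using fock_space_add[OF _ fock_space_mult_const[of _ "-1"]] by simp
lift_definition scaleR_fock :: "real \<Rightarrow> fock \<Rightarrow> fock" is "\<lambda>r f z. complex_of_real r * f z"
  by (rule fock_space_mult_const)

instance
  by standard (transfer; auto simp: algebra_simps)+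

end

definition fock_inner :: "fock \<Rightarrow> fock \<Rightarrow> complex" where
  "fock_inner f g = l2_inner (apply_fock f) (apply_fock g)"

lemma apply_fock_square_integrable: "square_integrable (apply_fock f)"
  using apply_fock[of f] by (simp add: fock_space_def)

lemma fock_inner_add_left: "fock_inner (f + g) h = fock_inner f h + fock_inner g h"
  by (simp add: fock_inner_def l2_inner_def plus_fock.rep_eq distrib_right
      integrable_l2_inner apply_fock_square_integrable)

lemma fock_inner_scaleR_left: "fock_inner (scaleR r f) g = complex_of_real r * fock_inner f g"
  by (simp add: fock_inner_def l2_inner_def scaleR_fock.rep_eq mult.assoc)

lemma fock_inner_commute: "fock_inner f g = cnj (fock_inner g f)"
  by (simp add: fock_inner_def l2_inner_def mult.commute flip: Bochner_Integration.integral_cnj)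

lemma fock_inner_self:
  "fock_inner f f = complex_of_real (LINT z|gauss. (cmod (apply_fock f z))\<^sup>2)"
  unfolding fock_inner_def l2_inner_def complex_norm_square[symmetric]
  by (simp del: of_real_power)

text \<open>The real part of the Hermitian inner product induces the norm of the Fock space.\<close>

instantiation fock :: real_inner
begin

definition inner_fock :: "fock \<Rightarrow> fock \<Rightarrow> real" where
  "inner_fock f g = Re (fock_inner f g)"
definition norm_fock :: "fock \<Rightarrow> real" where
  "norm_fock f = sqrt (inner f f)"
definition sgn_fock :: "fock \<Rightarrow> fock" where
  "sgn_fock f = f /\<^sub>R norm f"
definition dist_fock :: "fock \<Rightarrow> fock \<Rightarrow> real" where
  "dist_fock f g = norm (f - g)"
definition uniformity_fock :: "(fock \<times> fock) filter" where
  "uniformity_fock = (INF e\<in>{0<..}. principal {(x, y). dist x y < e})"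
definition open_fock :: "fock set \<Rightarrow> bool" where
  "open_fock U \<longleftrightarrow> (\<forall>x\<in>U. eventually (\<lambda>(x', y). x' = x \<longrightarrow> y \<in> U) uniformity)"

instance
proof
  fix f g h :: fock and r :: real
  show "inner f g = inner g f"
    unfolding inner_fock_def by (subst fock_inner_commute) simp
  show "inner (f + g) h = inner f h + inner g h"
    by (simp add: inner_fock_def fock_inner_add_left)
  show "inner (scaleR r f) g = r * inner f g"
    by (simp add: inner_fock_def fock_inner_scaleR_left)
  show "0 \<le> inner f f"
    by (simp add: inner_fock_def fock_inner_self)
  show "inner f f = 0 \<longleftrightarrow> f = 0"
  proof
    assume "inner f f = 0"
    then have "l2_inner (apply_fock f) (apply_fock f) = 0"
      by (metis Re_complex_of_real fock_inner_def fock_inner_self inner_fock_def of_real_0)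
    then have "apply_fock f z = 0" for z
      using apply_fock l2_inner_self_eq_zero by blast
    then show "f = 0"
      by (simp add: apply_fock_inject[symmetric] zero_fock.rep_eq fun_eq_iff)
  next
    assume "f = 0"
    then show "inner f f = 0"
      by (simp add: inner_fock_def fock_inner_self zero_fock.rep_eq)
  qed
qed (fact norm_fock_def sgn_fock_def dist_fock_def uniformity_fock_def open_fock_def)+

end

lemma norm_fock_eq: "norm (f :: fock) = sqrt (LINT z|gauss. (cmod (apply_fock f z))\<^sup>2)"
  by (simp add: norm_fock_def inner_fock_def fock_inner_self)

lift_definition scaleC_fock :: "complex \<Rightarrow> fock \<Rightarrow> fock" is "\<lambda>c f z. c * f z"
  by (rule fock_space_mult_const)

lemma norm_scaleC_fock: "norm (scaleC_fock c f) = cmod c * norm f"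
  by (simp add: norm_fock_eq scaleC_fock.rep_eq norm_mult power_mult_distrib real_sqrt_mult)

lift_definition mult_op :: "complex \<Rightarrow> fock \<Rightarrow>\<^sub>L fock" is scaleC_fock
proof (rule bounded_linear_intro)
  fix c :: complex and r :: real and f g :: fock
  show "scaleC_fock c (f + g) = scaleC_fock c f + scaleC_fock c g"
    by transfer (auto simp: algebra_simps)
  show "scaleC_fock c (scaleR r f) = scaleR r (scaleC_fock c f)"
    by transfer (auto simp: algebra_simps)
  show "norm (scaleC_fock c f) \<le> norm f * cmod c"
    by (simp add: norm_scaleC_fock)
qed

text \<open>The type \<open>fock \<Rightarrow>\<^sub>L fock\<close> consists of the bounded real-linear maps, so that
  \<open>\<L>(F\<^sup>2)\<close> is the following subset of it.\<close>

definition fock_operators :: "(fock \<Rightarrow>\<^sub>L fock) set" where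
  "fock_operators = {A. \<forall>c f. blinfun_apply A (scaleC_fock c f) = scaleC_fock c (blinfun_apply A f)}"

definition is_adjoint :: "(fock \<Rightarrow>\<^sub>L fock) \<Rightarrow> (fock \<Rightarrow>\<^sub>L fock) \<Rightarrow> bool" where
  "is_adjoint A B \<longleftrightarrow>
     (\<forall>f g. fock_inner (blinfun_apply A f) g = fock_inner f (blinfun_apply B g))"

definition cstar_subalgebra :: "(fock \<Rightarrow>\<^sub>L fock) set \<Rightarrow> bool" where
  "cstar_subalgebra S \<longleftrightarrow>
     S \<subseteq> fock_operators \<and> 0 \<in> S \<and>
     (\<forall>A\<in>S. \<forall>B\<in>S. A + B \<in> S) \<and>
     (\<forall>A\<in>S. \<forall>c. mult_op c o\<^sub>L A \<in> S) \<and>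
     (\<forall>A\<in>S. \<forall>B\<in>S. A o\<^sub>L B \<in> S) \<and>
     (\<forall>A\<in>S. \<forall>B\<in>fock_operators. is_adjoint A B \<longrightarrow> B \<in> S) \<and>
     closed S"

text \<open>Orthogonal projection onto \<open>F\<^sup>2\<close>; meaningful for square integrable \<open>g\<close>.\<close>

definition fock_proj :: "(complex \<Rightarrow> complex) \<Rightarrow> fock" where
  "fock_proj g = (THE h. \<forall>k. l2_inner (\<lambda>z. g z - apply_fock h z) (apply_fock k) = 0)"

lemma fock_proj_eqI:
  assumes "square_integrable g"
    and h: "\<And>k. l2_inner (\<lambda>z. g z - apply_fock h z) (apply_fock k) = 0"
  shows "fock_proj g = h"
  unfolding fock_proj_def
proof (rule the_equality)
  fix h' assume h': "\<forall>k. l2_inner (\<lambda>z. g z - apply_fock h' z) (apply_fock k) = 0"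
  have sq: "square_integrable (\<lambda>z. g z - apply_fock u z)" for u
    using square_integrable_add[OF assms(1)
        square_integrable_mult_const[OF apply_fock_square_integrable[of u], of "-1"]] by simp
  have "fock_inner (h' - h) k = l2_inner (\<lambda>z. g z - apply_fock h z) (apply_fock k)
      - l2_inner (\<lambda>z. g z - apply_fock h' z) (apply_fock k)" for k
    unfolding fock_inner_def l2_inner_def
    by (subst Bochner_Integration.integral_diff[symmetric,
          OF integrable_l2_inner[OF sq apply_fock_square_integrable]
             integrable_l2_inner[OF sq apply_fock_square_integrable]])
       (simp add: minus_fock.rep_eq algebra_simps)
  then have "fock_inner (h' - h) (h' - h) = 0"
    using h h' by simp
  then have "inner (h' - h) (h' - h) = 0"
    by (simp add: inner_fock_def)
  then show "h' = h" by simp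
qed (use h in blast)

lemma fock_proj_apply_fock: "fock_proj (apply_fock h) = h"
  by (rule fock_proj_eqI) (auto simp: apply_fock_square_integrable l2_inner_def)

text \<open>Almost everywhere refers to Lebesgue measure, equivalently to \<^const>\<open>gauss\<close>.\<close>

definition ess_bounded :: "(complex \<Rightarrow> complex) \<Rightarrow> bool" where
  "ess_bounded f \<longleftrightarrow> f \<in> borel_measurable lborel \<and> (\<exists>C. AE z in lborel. cmod (f z) \<le> C)"

definition toeplitz_operators :: "(fock \<Rightarrow>\<^sub>L fock) set" where
  "toeplitz_operators =
     {A \<in> fock_operators. \<exists>f. ess_bounded f \<and>
        (\<forall>g. blinfun_apply A g = fock_proj (\<lambda>z. f z * apply_fock g z))}"

definition toeplitz_algebra :: "(fock \<Rightarrow>\<^sub>L fock) set" where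
  "toeplitz_algebra = \<Inter> {S. cstar_subalgebra S \<and> toeplitz_operators \<subseteq> S}"

definition weighted_comp ::
    "(complex \<Rightarrow> complex) \<Rightarrow> (complex \<Rightarrow> complex) \<Rightarrow> (complex \<Rightarrow> complex) \<Rightarrow> complex \<Rightarrow> complex" where
  "weighted_comp \<psi> \<phi> f = (\<lambda>w. \<psi> w * f (\<phi> w))"

text \<open>A bounded operator \<open>A\<close> on \<open>F\<^sup>2\<close> is the operator given by the formula \<open>\<Phi>\<close> on functions;
  in particular \<open>\<Phi>\<close> then maps \<open>F\<^sup>2\<close> into itself.\<close>

definition acts_as ::
    "(fock \<Rightarrow>\<^sub>L fock) \<Rightarrow> ((complex \<Rightarrow> complex) \<Rightarrow> complex \<Rightarrow> complex) \<Rightarrow> bool" where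
  "acts_as A \<Phi> \<longleftrightarrow> (\<forall>f. apply_fock (blinfun_apply A f) = \<Phi> (apply_fock f))"

definition compact_operator :: "(fock \<Rightarrow>\<^sub>L fock) \<Rightarrow> bool" where
  "compact_operator A \<longleftrightarrow> compact (closure (blinfun_apply A ` cball 0 1))"

definition normalized_kernel :: "complex \<Rightarrow> complex \<Rightarrow> complex" where
  "normalized_kernel z w = exp (w * cnj z - complex_of_real ((cmod z)\<^sup>2 / 2))"

lemma gauss_weyl_pointwise:
  "exp (- (cmod w)\<^sup>2) * (cmod (normalized_kernel z w))\<^sup>2 = exp (- (cmod (w - z))\<^sup>2)"
proof -
  have "(cmod (normalized_kernel z w))\<^sup>2 = exp (2 * (Re (w * cnj z) - (cmod z)\<^sup>2 / 2))"
    by (simp add: normalized_kernel_def exp_double[symmetric] flip: exp_of_nat_mult)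
  moreover have "- (cmod w)\<^sup>2 + 2 * (Re (w * cnj z) - (cmod z)\<^sup>2 / 2) = - (cmod (w - z))\<^sup>2"
    by (simp add: cmod_power2 power2_diff algebra_simps) 
  ultimately show ?thesis
    by (simp flip: exp_add)
qed

lemma has_bochner_integral_translate:
  fixes f :: "complex \<Rightarrow> real"
  assumes "integrable lborel f"
  shows "integrable lborel (\<lambda>w. f (w - z))" "(LINT w|lborel. f (w - z)) = (LINT w|lborel. f w)"
proof -
  have shift: "(+) (- z) = (\<lambda>w. w - z)"
    by (auto simp: fun_eq_iff)
  have d: "lborel = distr lborel borel (\<lambda>w. w - z)"
    using lborel_distr_plus[of "- z"] by (simp add: shift)
  have m: "f \<in> borel_measurable borel"
    using assms by auto
  show "integrable lborel (\<lambda>w. f (w - z))"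
    using assms m by (subst (asm) d) (simp add: integrable_distr_eq)
  show "(LINT w|lborel. f (w - z)) = (LINT w|lborel. f w)"
    using m by (subst (2) d) (simp add: integral_distr)
qed

lemma weyl_isometry:
  assumes "f holomorphic_on UNIV" "integrable gauss (\<lambda>w. (cmod (f w))\<^sup>2)"
  shows "integrable gauss (\<lambda>w. (cmod (normalized_kernel z w * f (w - z)))\<^sup>2)"
    "(LINT w|gauss. (cmod (normalized_kernel z w * f (w - z)))\<^sup>2) = (LINT w|gauss. (cmod (f w))\<^sup>2)"
proof -
  define G where "G = (\<lambda>w. exp (- (cmod w)\<^sup>2) / pi * (cmod (f w))\<^sup>2)"
  have [measurable]: "f \<in> borel_measurable borel"
    using assms(1) by (rule entire_measurable)
  have hol: "(\<lambda>w. normalized_kernel z w * f (w - z)) holomorphic_on UNIV"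
    unfolding normalized_kernel_def
    by (intro holomorphic_intros holomorphic_on_compose_gen[OF _ assms(1), unfolded o_def]) auto
  have [measurable]: "(\<lambda>w. normalized_kernel z w * f (w - z)) \<in> borel_measurable borel"
    using hol by (rule entire_measurable)
  have G: "integrable lborel G"
    using assms(2) unfolding gauss_def G_def by (subst (asm) integrable_density) auto
  have eq: "exp (- (cmod w)\<^sup>2) / pi * (cmod (normalized_kernel z w * f (w - z)))\<^sup>2 = G (w - z)" for w
    unfolding G_def gauss_weyl_pointwise[of w z, symmetric]
    by (simp add: norm_mult power_mult_distrib)
  show "integrable gauss (\<lambda>w. (cmod (normalized_kernel z w * f (w - z)))\<^sup>2)"
    unfolding gauss_def using has_bochner_integral_translate(1)[OF G, of z]
    by (subst integrable_density) (auto simp: eq simp del: times_divide_eq_left)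
  have "(LINT w|gauss. (cmod (normalized_kernel z w * f (w - z)))\<^sup>2) = (LINT w|lborel. G (w - z))"
    unfolding gauss_def by (subst integral_density) (auto simp: eq simp del: times_divide_eq_left)
  also have "\<dots> = (LINT w|lborel. G w)"
    by (rule has_bochner_integral_translate(2)[OF G])
  also have "\<dots> = (LINT w|gauss. (cmod (f w))\<^sup>2)"
    unfolding gauss_def by (subst integral_density) (auto simp: G_def)
  finally show "(LINT w|gauss. (cmod (normalized_kernel z w * f (w - z)))\<^sup>2) =
    (LINT w|gauss. (cmod (f w))\<^sup>2)" .
qed

lemma fock_space_weyl:
  assumes "f \<in> fock_space"
  shows "(\<lambda>w. normalized_kernel z w * f (w - z)) \<in> fock_space"
proof -
  have f: "f holomorphic_on UNIV" "integrable gauss (\<lambda>w. (cmod (f w))\<^sup>2)"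
    using assms by (auto simp: fock_space_def square_integrable_def)
  have hol: "(\<lambda>w. normalized_kernel z w * f (w - z)) holomorphic_on UNIV"
    unfolding normalized_kernel_def
    by (intro holomorphic_intros holomorphic_on_compose_gen[OF _ f(1), unfolded o_def]) auto
  then show ?thesis
    using weyl_isometry(1)[OF f, of z] entire_measurable[OF hol]
    by (simp add: fock_space_def square_integrable_def)
qed

lift_definition weyl_fock :: "complex \<Rightarrow> fock \<Rightarrow> fock"
  is "\<lambda>z f w. normalized_kernel z w * f (w - z)"
  by (rule fock_space_weyl)

lift_definition weyl_op :: "complex \<Rightarrow> fock \<Rightarrow>\<^sub>L fock" is weyl_fock
proof (rule bounded_linear_intro)
  fix z :: complex and r :: real and f g :: fock
  show "weyl_fock z (f + g) = weyl_fock z f + weyl_fock z g"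
    by transfer (auto simp: algebra_simps)
  show "weyl_fock z (scaleR r f) = scaleR r (weyl_fock z f)"
    by transfer (auto simp: algebra_simps)
  have "norm (weyl_fock z f) = norm f"
    using apply_fock[of f] weyl_isometry(2)[of "apply_fock f" z]
    by (simp add: norm_fock_eq weyl_fock.rep_eq fock_space_def square_integrable_def)
  then show "norm (weyl_fock z f) \<le> norm f * 1"
    by simp
qed

end

theory Submission
  imports Defs "HOL-Probability.Distributions" "HOL-Real_Asymp.Real_Asymp"
begin

text \<open>The operators \<open>A\<close> with \<open>A W\<^sub>z - W\<^sub>z A \<longlonglongrightarrow> 0\<close> in norm as \<open>z \<longlonglongrightarrow> 0\<close> form a C*-algebra that contains
  the Toeplitz operators, hence the Toeplitz algebra. Boundedness of a nonzero \<open>W = W\<^sub>\<psi>\<^sub>,\<^sub>\<phi>\<close> forces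
  \<open>\<phi> w = a * w + b\<close>. If \<open>a \<noteq> 1\<close>, then \<open>W\<close> moves mass from \<open>\<phi> w\<close> to the distant point \<open>w\<close>, where the Weyl
  operator \<open>W\<^sub>z\<close> has an opposite phase for a suitable small \<open>z\<close>; so the commutators with \<open>W\<^sub>z\<close> can only
  be small if the weight \<open>cmod (\<psi> w) * exp ((cmod (\<phi> w))\<^sup>2 / 2 - (cmod w)\<^sup>2 / 2)\<close> vanishes at infinity,
  and this makes \<open>W\<close> compact. If \<open>a = 1\<close>, then the weight is the modulus of a bounded entire function, and
  Liouville's theorem identifies \<open>W\<close> with a multiple of a Weyl operator.\<close>

section \<open>Lebesgue measure on the complex plane\<close>

text \<open>Smallness in norm of the commutator with a Toeplitz operator is not evident: the symbol
  is merely measurable, and near a point \<open>w\<close> the operator \<open>W\<^sub>z\<close>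
  multiplies by the phase \<open>exp (w * cnj z - z * cnj w)\<close>, which turns ever faster as
  \<open>w\<close> grows. Two facts rescue the estimate. In the sesquilinear form of the commutator
  both terms carry the same phase, so it disappears in modulus; and entire functions, recentred at
  \<open>w\<close>, change by \<open>O(cmod z)\<close> under a shift by \<open>z\<close>, uniformly
  in \<open>w\<close>. A composition operator, by contrast, compares the phase at
  \<open>\<phi> w\<close> with the phase at \<open>w\<close>. For a suitable direction of
  \<open>z\<close> these are opposite once \<open>z\<close> has size
  \<open>pi / (2 * cmod (\<phi> w - w))\<close>, and such \<open>z\<close> shrink to 0 when the
  displacement tends to infinity; this singles out slope 1 as the exceptional case. The test vectors
  are normalized reproducing kernels at \<open>\<phi> w\<close>, which attain the pointwise bound of
  the Fock space there.\<close>

lemma nn_integral_lborel_translate: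
  fixes f :: "'a::euclidean_space \<Rightarrow> ennreal"
  assumes [measurable]: "f \<in> borel_measurable borel"
  shows "(\<integral>\<^sup>+x. f (c + x) \<partial>lborel) = (\<integral>\<^sup>+x. f x \<partial>lborel)"
proof -
  have "(\<integral>\<^sup>+x. f x \<partial>lborel) = (\<integral>\<^sup>+x. f x \<partial>distr lborel borel ((+) c))"
    by (simp add: lborel_distr_plus)
  also have "\<dots> = (\<integral>\<^sup>+x. f (c + x) \<partial>lborel)"
    by (rule nn_integral_distr) auto
  finally show ?thesis by simp
qed

lemma emeasure_lborel_ball:
  fixes c :: "'a::euclidean_space"
  assumes "r \<ge> 0"
  shows "emeasure lborel (ball c r) = ennreal (r ^ DIM('a)) * emeasure lborel (ball (0::'a) 1)"
  using emeasure_lebesgue_ball_conv_unit_ball[OF assms, of c] by simp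

text \<open>As in the proof of uniqueness of Haar measure, the double integral of
  \<open>indicator (ball 0 1) x * g (x + a * z)\<close> is evaluated in both orders.\<close>

lemma nn_integral_lborel_complex_mult:
  fixes g :: "complex \<Rightarrow> ennreal"
  assumes [measurable]: "g \<in> borel_measurable borel" and "a \<noteq> 0"
  shows "(\<integral>\<^sup>+z. g (a * z) \<partial>lborel) = ennreal (1 / (cmod a)\<^sup>2) * (\<integral>\<^sup>+z. g z \<partial>lborel)"
proof -
  have [measurable]: "(\<lambda>z. c * z) \<in> borel_measurable borel" for c :: complex
    by (intro borel_measurable_continuous_onI continuous_intros)
  let ?B = "ball (0::complex) 1"
  have [measurable, simp]: "ball c r \<in> sets borel" for c :: complex and r
    by simp
  define b where "b = emeasure lborel ?B"
  have b: "b \<noteq> 0" "b \<noteq> \<infinity>"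
  proof -
    have "measure lborel ?B > 0" by (rule content_ball_pos) simp
    then show "b \<noteq> 0" by (auto simp: b_def measure_def)
    show "b \<noteq> \<infinity>" using emeasure_lborel_ball_finite[of "0::complex" 1] by (simp add: b_def)
  qed
  have "b * (\<integral>\<^sup>+z. g (a * z) \<partial>lborel) = (\<integral>\<^sup>+x. indicator ?B x * (\<integral>\<^sup>+z. g (a * z) \<partial>lborel) \<partial>lborel)"
    unfolding b_def by (subst nn_integral_multc) simp_all
  also have "\<dots> = (\<integral>\<^sup>+x. \<integral>\<^sup>+z. indicator ?B x * g (x + a * z) \<partial>lborel \<partial>lborel)"
  proof (rule nn_integral_cong)
    fix x
    have "(\<integral>\<^sup>+z. g (a * z) \<partial>lborel) = (\<integral>\<^sup>+z. g (a * (x / a + z)) \<partial>lborel)"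
      by (rule nn_integral_lborel_translate[symmetric]) measurable
    also have "\<dots> = (\<integral>\<^sup>+z. g (x + a * z) \<partial>lborel)"
      using \<open>a \<noteq> 0\<close> by (simp add: distrib_left)
    finally show "indicator ?B x * (\<integral>\<^sup>+z. g (a * z) \<partial>lborel)
        = (\<integral>\<^sup>+z. indicator ?B x * g (x + a * z) \<partial>lborel)"
      by (simp add: nn_integral_cmult)
  qed
  also have "\<dots> = (\<integral>\<^sup>+z. \<integral>\<^sup>+x. indicator ?B x * g (x + a * z) \<partial>lborel \<partial>lborel)"
    by (rule lborel_pair.Fubini'[symmetric]) measurable
  also have "\<dots> = (\<integral>\<^sup>+z. \<integral>\<^sup>+x. indicator ?B (x - a * z) * g x \<partial>lborel \<partial>lborel)"
  proof (rule nn_integral_cong)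
    fix z
    have "(\<integral>\<^sup>+x. indicator ?B (a * z + x - a * z) * g (a * z + x) \<partial>lborel)
        = (\<integral>\<^sup>+x. indicator ?B (x - a * z) * g x \<partial>lborel)"
      by (rule nn_integral_lborel_translate) measurable
    then show "(\<integral>\<^sup>+x. indicator ?B x * g (x + a * z) \<partial>lborel)
        = (\<integral>\<^sup>+x. indicator ?B (x - a * z) * g x \<partial>lborel)"
      by (simp add: add.commute)
  qed
  also have "\<dots> = (\<integral>\<^sup>+x. \<integral>\<^sup>+z. indicator ?B (x - a * z) * g x \<partial>lborel \<partial>lborel)"
    by (rule lborel_pair.Fubini') measurable
  also have "\<dots> = (\<integral>\<^sup>+x. (ennreal (1 / (cmod a)\<^sup>2) * b) * g x \<partial>lborel)"
  proof (rule nn_integral_cong)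
    fix x
    have eq: "(indicator ?B (x - a * z) :: ennreal) = indicator (ball (x / a) (1 / cmod a)) z" for z
    proof -
      have "cmod (x - a * z) = cmod a * cmod (x / a - z)"
        using \<open>a \<noteq> 0\<close> by (simp add: right_diff_distrib flip: norm_mult)
      then have "cmod (x - a * z) < 1 \<longleftrightarrow> cmod (x / a - z) < 1 / cmod a"
        using \<open>a \<noteq> 0\<close> by (simp add: less_divide_eq mult.commute)
      then show ?thesis
        by (simp add: indicator_def dist_norm norm_minus_commute)
    qed
    have "(\<integral>\<^sup>+z. indicator ?B (x - a * z) * g x \<partial>lborel) = emeasure lborel (ball (x / a) (1 / cmod a)) * g x"
      by (simp add: eq nn_integral_multc)
    also have "emeasure lborel (ball (x / a) (1 / cmod a)) = ennreal (1 / (cmod a)\<^sup>2) * b"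
      by (subst emeasure_lborel_ball) (auto simp: b_def power_divide)
    finally show "(\<integral>\<^sup>+z. indicator ?B (x - a * z) * g x \<partial>lborel) = (ennreal (1 / (cmod a)\<^sup>2) * b) * g x" .
  qed
  also have "\<dots> = b * (ennreal (1 / (cmod a)\<^sup>2) * (\<integral>\<^sup>+z. g z \<partial>lborel))"
    by (subst nn_integral_cmult) (simp_all add: mult_ac)
  finally show ?thesis
    using b by (simp add: ennreal_mult_cancel_left)
qed

section \<open>Mean values on circles\<close>

definition circ :: "real \<Rightarrow> complex" where
  "circ t = exp (2 * of_real pi * \<i> * of_real t)"

lemma norm_circ [simp]: "cmod (circ t) = 1"
  by (simp add: circ_def norm_exp_eq_Re)

lemma circ_nonzero [simp]: "circ t \<noteq> 0"
  by (simp add: circ_def)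

lemma continuous_circ [continuous_intros]: "continuous_on S circ"
  unfolding circ_def by (intro continuous_intros)

text \<open>The derivative of the circle path cancels the factor \<open>2 * pi * \<i>\<close>. The
  case \<open>u = 0\<close> is the mean value property; the difference between a general
  \<open>u\<close> and 0 controls increments of \<open>f\<close>.\<close>

lemma Cauchy_integral_unit_circle:
  assumes "f holomorphic_on UNIV" "cmod u < 1"
  shows "((\<lambda>t. f (circ t) * (circ t / (circ t - u))) has_integral f u) {0..1}"
proof -
  define P where "P = 2 * of_real pi * \<i>"
  have "((\<lambda>v. f v / (v - u)) has_contour_integral (2 * of_real pi * \<i> * f u)) (circlepath 0 1)"
    using assms by (intro Cauchy_integral_circlepath_simple) (auto intro: holomorphic_on_subset)
  then have "((\<lambda>t. f (circ t) / (circ t - u) * (P * circ t)) has_integral P * f u) {0..1}"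
    unfolding has_contour_integral P_def
    by (rule has_integral_eq[rotated])
      (simp add: vector_derivative_circlepath, simp add: circlepath circ_def)
  then have "((\<lambda>t. 1 / P * (f (circ t) / (circ t - u) * (P * circ t))) has_integral 1 / P * (P * f u)) {0..1}"
    by (rule has_integral_mult_right)
  moreover have "P \<noteq> 0" by (simp add: P_def)
  ultimately show ?thesis
    by simp
qed

lemma nn_integral_Icc_continuous:
  fixes h :: "real \<Rightarrow> real"
  assumes "continuous_on {a..b} h" "\<And>t. t \<in> {a..b} \<Longrightarrow> 0 \<le> h t"
  shows "(\<integral>\<^sup>+t\<in>{a..b}. ennreal (h t) \<partial>lborel) = ennreal (integral {a..b} h)"
  using assms(1) by (intro nn_integral_has_integral_lebesgue' assms(2) integrable_integral
      integrable_continuous_interval)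

lemma norm_has_integral_le_nn_integral:
  fixes f :: "real \<Rightarrow> complex"
  assumes "(f has_integral I) {a..b}" "continuous_on {a..b} f"
  shows "ennreal (cmod I) \<le> (\<integral>\<^sup>+t\<in>{a..b}. ennreal (cmod (f t)) \<partial>lborel)"
proof -
  have c: "continuous_on {a..b} (\<lambda>t. cmod (f t))"
    using assms(2) by (intro continuous_intros)
  have "cmod I \<le> integral {a..b} (\<lambda>t. cmod (f t))"
    using assms c
    by (metis integral_unique integral_norm_bound_integral order_refl integrable_continuous_interval)
  then show ?thesis
    by (subst nn_integral_Icc_continuous[OF c]) (auto intro: ennreal_leI)
qed

text \<open>The mean value property of \<open>f\<^sup>2\<close> replaces the use of Jensen's inequality.\<close>

lemma square_submean:
  assumes f: "f holomorphic_on UNIV"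
  shows "ennreal ((cmod (f 0))\<^sup>2) \<le> (\<integral>\<^sup>+t\<in>{0..1}. ennreal ((cmod (f (circ t * v)))\<^sup>2) \<partial>lborel)"
proof -
  define g where "g = (\<lambda>z. (f (z * v))\<^sup>2)"
  have g: "g holomorphic_on UNIV"
    unfolding g_def
    by (intro holomorphic_intros holomorphic_on_compose_gen[OF _ f, unfolded o_def]) auto
  then have "continuous_on UNIV g" by (rule holomorphic_on_imp_continuous_on)
  then have c: "continuous_on {0..1} (\<lambda>t. g (circ t))"
    by (rule continuous_on_compose2) (auto intro: continuous_circ)
  have "((\<lambda>t. g (circ t)) has_integral g 0) {0..1}"
    using Cauchy_integral_unit_circle[OF g, of 0] by simp
  from norm_has_integral_le_nn_integral[OF this c]
  show ?thesis by (simp add: g_def norm_power)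
qed

text \<open>Subtracting the Cauchy formulas at \<open>u\<close> and at 0 leaves the kernel
  \<open>u / (circ t - u)\<close>, of modulus at most \<open>2 * cmod u\<close>. Cauchy-Schwarz on
  the unit interval then gives the factor \<open>4 * (cmod u)\<^sup>2\<close>.\<close>

lemma square_increment_le:
  assumes f: "f holomorphic_on UNIV" and u: "cmod u \<le> 1/2"
  shows "ennreal ((cmod (f u - f 0))\<^sup>2)
    \<le> ennreal (4 * (cmod u)\<^sup>2) * (\<integral>\<^sup>+t\<in>{0..1}. ennreal ((cmod (f (circ t)))\<^sup>2) \<partial>lborel)"
proof -
  have cf: "continuous_on UNIV f" using f by (rule holomorphic_on_imp_continuous_on)
  have [measurable]: "(\<lambda>t. f (circ t)) \<in> borel_measurable borel"
    by (intro borel_measurable_continuous_onI continuous_on_compose2[OF cf] continuous_circ) auto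
  have ne: "circ t - u \<noteq> 0" for t
  proof 
    assume "circ t - u = 0"
    then have "cmod u = 1" using norm_circ[of t] by simp
    then show False using u by simp
  qed
  let ?h = "\<lambda>t. f (circ t) * (u / (circ t - u))"
  have "((\<lambda>t. f (circ t) * (circ t / (circ t - u)) - f (circ t) * (circ t / (circ t - 0))) 
      has_integral f u - f 0) {0..1}"
    using u by (intro has_integral_diff Cauchy_integral_unit_circle[OF f]) auto
  then have "(?h has_integral f u - f 0) {0..1}"
    by (rule has_integral_eq[rotated]) (use ne in \<open>simp add: field_simps\<close>)
  moreover have "continuous_on {0..1} ?h"
    using ne by (intro continuous_intros continuous_on_compose2[OF cf]) auto
  ultimately have "ennreal (cmod (f u - f 0)) \<le> (\<integral>\<^sup>+t\<in>{0..1}. ennreal (cmod (?h t)) \<partial>lborel)"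
    by (rule norm_has_integral_le_nn_integral)
  also have "\<dots> \<le> (\<integral>\<^sup>+t. ennreal (2 * cmod u) * indicator {0..1} t * (ennreal (cmod (f (circ t))) * indicator {0..1} t) \<partial>lborel)"
  proof (intro nn_integral_mono)
    fix t
    have "1 / 2 \<le> cmod (circ t - u)"
      using norm_triangle_ineq2[of "circ t" u] u by simp
    then have "cmod u / cmod (circ t - u) \<le> cmod u / (1/2)"
      by (intro divide_left_mono) auto
    then have "cmod (?h t) \<le> 2 * cmod u * cmod (f (circ t))"
      using mult_left_mono[OF _ norm_ge_zero, of _ _ "f (circ t)"]
      by (fastforce simp: norm_mult norm_divide mult_ac)
    then have "ennreal (cmod (?h t)) \<le> ennreal (2 * cmod u) * ennreal (cmod (f (circ t)))"
      by (simp add: ennreal_leI flip: ennreal_mult)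
    then show "ennreal (cmod (?h t)) * indicator {0..1} t
      \<le> ennreal (2 * cmod u) * indicator {0..1} t * (ennreal (cmod (f (circ t))) * indicator {0..1} t)"
      by (auto simp: indicator_def)
  qed
  finally have "ennreal (cmod (f u - f 0)) ^ 2 \<le> \<dots> ^ 2"
    by (intro power_mono) auto
  also have "\<dots> \<le> (\<integral>\<^sup>+t. (ennreal (2 * cmod u) * indicator {0..1::real} t)\<^sup>2 \<partial>lborel) *
       (\<integral>\<^sup>+t. (ennreal (cmod (f (circ t))) * indicator {0..1} t)\<^sup>2 \<partial>lborel)"
    by (rule Cauchy_Schwarz_nn_integral) measurable
  also have "(\<integral>\<^sup>+t. (ennreal (2 * cmod u) * indicator {0..1::real} t)\<^sup>2 \<partial>lborel) = ennreal (4 * (cmod u)\<^sup>2)"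
  proof -
    have "(\<integral>\<^sup>+t. (ennreal (2 * cmod u) * indicator {0..1::real} t)\<^sup>2 \<partial>lborel) 
      = (\<integral>\<^sup>+t. ennreal (4 * (cmod u)\<^sup>2) * indicator {0..1::real} t \<partial>lborel)"
      by (intro nn_integral_cong) (auto simp: indicator_def ennreal_power power_mult_distrib simp del: ennreal_mult'')
    then show ?thesis by (simp add: nn_integral_cmult)
  qed
  also have "(\<integral>\<^sup>+t. (ennreal (cmod (f (circ t))) * indicator {0..1} t)\<^sup>2 \<partial>lborel)
     = (\<integral>\<^sup>+t\<in>{0..1}. ennreal ((cmod (f (circ t)))\<^sup>2) \<partial>lborel)"
    by (intro nn_integral_cong) (auto simp: indicator_def ennreal_power)
  finally show ?thesis by (simp add: ennreal_power)
qed

section \<open>Pointwise bounds in the Fock space\<close>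

lemma nn_integral_gaussian_real: "(\<integral>\<^sup>+(x::real). ennreal (exp (- x\<^sup>2)) \<partial>lborel) = ennreal (sqrt pi)"
proof -
  \<comment> \<open>Variance 1/2 is the one for which the exponent of the normal density is exactly
    \<open>- x\<^sup>2\<close>.\<close>
  have eq: "normal_density 0 (1 / sqrt 2) x = exp (- x\<^sup>2) / sqrt pi" for x
    by (simp add: normal_density_def power_divide)
  have "(\<integral>\<^sup>+x. ennreal (normal_density 0 (1 / sqrt 2) x) \<partial>lborel) = 1"
    by (subst nn_integral_eq_integral) (auto intro!: integrable_normal_density)
  then have "(\<integral>\<^sup>+(x::real). ennreal (1 / sqrt pi) * ennreal (exp (- x\<^sup>2)) \<partial>lborel) = 1"
    by (simp add: eq flip: ennreal_mult)
  then have "ennreal (sqrt pi) * (ennreal (1 / sqrt pi) * (\<integral>\<^sup>+(x::real). ennreal (exp (- x\<^sup>2)) \<partial>lborel)) = ennreal (sqrt pi)"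
    by (subst (asm) nn_integral_cmult) auto
  moreover have "ennreal (sqrt pi) * ennreal (1 / sqrt pi) = 1"
    by (simp flip: ennreal_mult)
  ultimately show ?thesis
    by (simp flip: mult.assoc)
qed

lemma nn_integral_gaussian_complex: "(\<integral>\<^sup>+(z::complex). ennreal (exp (- (cmod z)\<^sup>2)) \<partial>lborel) = ennreal pi"
proof -
  have "(\<integral>\<^sup>+(z::complex). ennreal (exp (- (cmod z)\<^sup>2)) \<partial>lborel)
      = (\<integral>\<^sup>+(z::complex). (\<Prod>b\<in>Basis. ennreal (exp (- (z \<bullet> b)\<^sup>2))) \<partial>lborel)"
  proof (rule nn_integral_cong)
    fix z :: complex
    show "ennreal (exp (- (cmod z)\<^sup>2)) = (\<Prod>b\<in>Basis. ennreal (exp (- (z \<bullet> b)\<^sup>2)))"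
      by (simp add: Basis_complex_def cmod_power2 inner_complex_def flip: ennreal_mult exp_add)
  qed
  also have "\<dots> = (\<Prod>b\<in>(Basis :: complex set). (\<integral>\<^sup>+x. ennreal (exp (- x\<^sup>2)) \<partial>lborel))"
    by (rule nn_integral_lborel_prod) auto
  also have "\<dots> = ennreal pi"
    by (simp add: nn_integral_gaussian_real Basis_complex_def flip: ennreal_mult)
  finally show ?thesis .
qed

section \<open>Fock norms as integrals over Lebesgue measure\<close>

lemma apply_fock_holomorphic: "apply_fock F holomorphic_on UNIV"
  using apply_fock[of F] by (simp add: fock_space_def)

lemma apply_fock_measurable [measurable]: "apply_fock F \<in> borel_measurable borel"
  by (rule entire_measurable[OF apply_fock_holomorphic])

lemma nn_integral_gauss:
  assumes [measurable]: "f \<in> borel_measurable borel" and "\<And>z. f z \<ge> 0"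
  shows "ennreal pi * (\<integral>\<^sup>+z. ennreal (f z) \<partial>gauss) = (\<integral>\<^sup>+z. ennreal (exp (- (cmod z)\<^sup>2) * f z) \<partial>lborel)"
proof -
  have "ennreal pi * (\<integral>\<^sup>+z. ennreal (f z) \<partial>gauss)
      = ennreal pi * (\<integral>\<^sup>+z. ennreal (exp (- (cmod z)\<^sup>2) / pi) * ennreal (f z) \<partial>lborel)"
    unfolding gauss_def by (subst nn_integral_density) auto
  also have "\<dots> = (\<integral>\<^sup>+z. ennreal pi * (ennreal (exp (- (cmod z)\<^sup>2) / pi) * ennreal (f z)) \<partial>lborel)"
    by (rule nn_integral_cmult[symmetric]) measurable
  also have "\<dots> = (\<integral>\<^sup>+z. ennreal (exp (- (cmod z)\<^sup>2) * f z) \<partial>lborel)"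
    by (rule nn_integral_cong) (simp add: assms(2) flip: ennreal_mult)
  finally show ?thesis .
qed

lemma nn_integral_apply_fock:
  "(\<integral>\<^sup>+z. ennreal (exp (- (cmod z)\<^sup>2) * (cmod (apply_fock F z))\<^sup>2) \<partial>lborel) = ennreal (pi * (norm F)\<^sup>2)"
proof -
  have int: "integrable gauss (\<lambda>z. (cmod (apply_fock F z))\<^sup>2)"
    using apply_fock_square_integrable[of F] by (simp add: square_integrable_def)
  have "(norm F)\<^sup>2 = (LINT z|gauss. (cmod (apply_fock F z))\<^sup>2)"
    by (simp add: norm_fock_eq)
  then have "(\<integral>\<^sup>+z. ennreal ((cmod (apply_fock F z))\<^sup>2) \<partial>gauss) = ennreal ((norm F)\<^sup>2)"
    using int by (subst nn_integral_eq_integral) auto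
  then show ?thesis
    by (subst nn_integral_gauss[symmetric]) (auto simp: ennreal_mult)
qed

text \<open>An upper bound on a nonnegative integral is the form in which Fatou's lemma delivers its
  conclusion, so membership and the norm bound are obtained from it together. The factor
  \<open>pi\<close> is the normalisation of \<open>gauss\<close>.\<close>

lemma fock_spaceI:
  assumes hol: "f holomorphic_on UNIV"
    and le: "(\<integral>\<^sup>+z. ennreal (exp (- (cmod z)\<^sup>2) * (cmod (f z))\<^sup>2) \<partial>lborel) \<le> ennreal (pi * c\<^sup>2)"
    and c: "c \<ge> 0"
  shows "f \<in> fock_space" "norm (Abs_fock f) \<le> c"
proof -
  have [measurable]: "f \<in> borel_measurable borel" using hol by (rule entire_measurable)
  have "(\<integral>\<^sup>+z. ennreal ((cmod (f z))\<^sup>2) \<partial>gauss) < \<infinity>"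
  proof (rule ccontr)
    assume "\<not> ?thesis"
    then have "(\<integral>\<^sup>+z. ennreal ((cmod (f z))\<^sup>2) \<partial>gauss) = \<infinity>"
      by (simp flip: less_top)
    then have "ennreal pi * (\<integral>\<^sup>+z. ennreal ((cmod (f z))\<^sup>2) \<partial>gauss) = \<infinity>"
      by (simp add: ennreal_mult_top)
    then show False
      using le by (subst (asm) nn_integral_gauss) (auto simp: top_unique)
  qed
  then have "integrable gauss (\<lambda>z. (cmod (f z))\<^sup>2)"
    by (intro integrableI_bounded) auto
  then show "f \<in> fock_space"
    using hol by (simp add: fock_space_def square_integrable_def)
  then have "ennreal (pi * (norm (Abs_fock f))\<^sup>2) \<le> ennreal (pi * c\<^sup>2)"
    using nn_integral_apply_fock[of "Abs_fock f"] le by (simp add: Abs_fock_inverse)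
  then have "(norm (Abs_fock f))\<^sup>2 \<le> c\<^sup>2"
    by (subst (asm) ennreal_le_iff) auto
  then show "norm (Abs_fock f) \<le> c"
    using c by (rule power2_le_imp_le)
qed

text \<open>\<open>fock_shift f w\<close> is the Weyl translate \<open>W\<^sub>-\<^sub>w f\<close>, which recentres \<open>f\<close> at \<open>w\<close>.\<close>

definition fock_shift :: "(complex \<Rightarrow> complex) \<Rightarrow> complex \<Rightarrow> complex \<Rightarrow> complex" where
  "fock_shift f w u = exp (- u * cnj w - of_real ((cmod w)\<^sup>2 / 2)) * f (w + u)"

text \<open>Completing the square moves the Gaussian weight to \<open>w + u\<close>; the remaining
  factor depends on \<open>u\<close> alone, which makes the local estimates uniform in the centre
  \<open>w\<close>.\<close>

lemma norm_fock_shift: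
  "(cmod (fock_shift f w u))\<^sup>2 = exp ((cmod u)\<^sup>2) * (exp (- (cmod (w + u))\<^sup>2) * (cmod (f (w + u)))\<^sup>2)"
proof -
  have "(cmod (exp (- u * cnj w - of_real ((cmod w)\<^sup>2 / 2))))\<^sup>2 = exp (2 * (- Re (u * cnj w) - (cmod w)\<^sup>2 / 2))"
    by (simp add: norm_exp_eq_Re flip: exp_of_nat_mult)
  also have "2 * (- Re (u * cnj w) - (cmod w)\<^sup>2 / 2) = (cmod u)\<^sup>2 - (cmod (w + u))\<^sup>2"
    by (simp add: cmod_power2 power2_sum algebra_simps)
  finally show ?thesis
    by (simp add: fock_shift_def norm_mult power_mult_distrib exp_diff exp_minus field_simps)
qed

lemma fock_shift_holomorphic:
  assumes "f holomorphic_on UNIV"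
  shows "fock_shift f w holomorphic_on UNIV"
  unfolding fock_shift_def [abs_def]
  by (intro holomorphic_intros holomorphic_on_compose_gen[OF _ assms, unfolded o_def]) auto

text \<open>Here the offset \<open>u\<close> is fixed and the centre \<open>w\<close> runs over the
  plane, so translation invariance applies. In this way a local estimate at every centre becomes an
  estimate by the global norm.\<close>

lemma nn_integral_fock_shift:
  "(\<integral>\<^sup>+w. ennreal ((cmod (fock_shift (apply_fock F) w u))\<^sup>2) \<partial>lborel) = ennreal (exp ((cmod u)\<^sup>2) * pi * (norm F)\<^sup>2)"
proof -
  let ?g = "\<lambda>z. ennreal (exp (- (cmod z)\<^sup>2) * (cmod (apply_fock F z))\<^sup>2)"
  have "(\<integral>\<^sup>+w. ennreal ((cmod (fock_shift (apply_fock F) w u))\<^sup>2) \<partial>lborel)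
     = (\<integral>\<^sup>+w. ennreal (exp ((cmod u)\<^sup>2)) * ?g (u + w) \<partial>lborel)"
    by (simp add: norm_fock_shift add.commute flip: ennreal_mult)
  also have "\<dots> = ennreal (exp ((cmod u)\<^sup>2)) * (\<integral>\<^sup>+w. ?g (u + w) \<partial>lborel)"
    by (rule nn_integral_cmult) measurable
  also have "(\<integral>\<^sup>+w. ?g (u + w) \<partial>lborel) = (\<integral>\<^sup>+w. ?g w \<partial>lborel)"
    by (rule nn_integral_lborel_translate) measurable
  also have "\<dots> = ennreal (pi * (norm F)\<^sup>2)" by (rule nn_integral_apply_fock)
  finally show ?thesis by (simp add: mult.assoc flip: ennreal_mult)
qed

text \<open>Recentring reduces the claim to the value at the origin of
  \<open>fock_shift (apply_fock F) w\<close>. There the submean inequality on circles is integrated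
  against the Gaussian, and the rotation is removed by Fubini and rotation invariance. Normalized
  kernels attain the bound.\<close>

lemma norm_apply_fock_le: "cmod (apply_fock F w) \<le> exp ((cmod w)\<^sup>2 / 2) * norm F"
proof -
  define g where "g = fock_shift (apply_fock F) w"
  have g: "g holomorphic_on UNIV"
    unfolding g_def by (rule fock_shift_holomorphic[OF apply_fock_holomorphic])
  have [measurable]: "g \<in> borel_measurable borel" using g by (rule entire_measurable)
  have [measurable]: "circ \<in> borel_measurable borel"
    by (intro borel_measurable_continuous_onI continuous_circ)
  let ?e = "\<lambda>v::complex. ennreal (exp (- (cmod v)\<^sup>2))"
  let ?E = "\<lambda>v. ennreal (exp (- (cmod v)\<^sup>2) * (cmod (g v))\<^sup>2)"
  have "ennreal (pi * (cmod (g 0))\<^sup>2) = (\<integral>\<^sup>+v. ?e v * ennreal ((cmod (g 0))\<^sup>2) \<partial>lborel)"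
    by (subst nn_integral_multc) (auto simp: nn_integral_gaussian_complex ennreal_mult)
  also have "\<dots> \<le> (\<integral>\<^sup>+v. (\<integral>\<^sup>+t. ?E (circ t * v) * indicator {0..1} t \<partial>lborel) \<partial>lborel)"
  proof (rule nn_integral_mono)
    fix v
    have "?e v * ennreal ((cmod (g 0))\<^sup>2) \<le> ?e v * (\<integral>\<^sup>+t\<in>{0..1}. ennreal ((cmod (g (circ t * v)))\<^sup>2) \<partial>lborel)"
      by (intro mult_left_mono square_submean g) auto
    also have "\<dots> = (\<integral>\<^sup>+t. ?e v * (ennreal ((cmod (g (circ t * v)))\<^sup>2) * indicator {0..1} t) \<partial>lborel)"
      by (rule nn_integral_cmult[symmetric]) measurable
    also have "\<dots> = (\<integral>\<^sup>+t. ?E (circ t * v) * indicator {0..1} t \<partial>lborel)"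
      by (rule nn_integral_cong) (simp add: norm_mult ennreal_mult mult.assoc)
    finally show "?e v * ennreal ((cmod (g 0))\<^sup>2) \<le> (\<integral>\<^sup>+t. ?E (circ t * v) * indicator {0..1} t \<partial>lborel)" .
  qed
  also have "\<dots> = (\<integral>\<^sup>+t. (\<integral>\<^sup>+v. ?E (circ t * v) * indicator {0..1} t \<partial>lborel) \<partial>lborel)"
    by (rule lborel_pair.Fubini') measurable
  also have "\<dots> = (\<integral>\<^sup>+t. (\<integral>\<^sup>+v. ?E v \<partial>lborel) * indicator {0..1::real} t \<partial>lborel)"
  proof (rule nn_integral_cong)
    fix t :: real
    have "(\<integral>\<^sup>+v. ?E (circ t * v) * indicator {0..1} t \<partial>lborel) = (\<integral>\<^sup>+v. ?E (circ t * v) \<partial>lborel) * indicator {0..1} t"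
      by (rule nn_integral_multc) measurable
    also have "(\<integral>\<^sup>+v. ?E (circ t * v) \<partial>lborel) = (\<integral>\<^sup>+v. ?E v \<partial>lborel)"
      by (subst nn_integral_lborel_complex_mult[of ?E "circ t"]) auto
    finally show "(\<integral>\<^sup>+v. ?E (circ t * v) * indicator {0..1} t \<partial>lborel) = (\<integral>\<^sup>+v. ?E v \<partial>lborel) * indicator {0..1::real} t" .
  qed
  also have "\<dots> = (\<integral>\<^sup>+v. ?E v \<partial>lborel)"
    by (subst nn_integral_cmult) auto
  also have "\<dots> = (\<integral>\<^sup>+v. ennreal (exp (- (cmod (w + v))\<^sup>2) * (cmod (apply_fock F (w + v)))\<^sup>2) \<partial>lborel)"
    by (rule nn_integral_cong) (simp add: g_def norm_fock_shift flip: mult.assoc exp_add)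
  also have "\<dots> = ennreal (pi * (norm F)\<^sup>2)"
    using nn_integral_apply_fock[of F]
    by (subst (asm) nn_integral_lborel_translate[symmetric, of _ w]) auto
  finally have "(cmod (g 0))\<^sup>2 \<le> (norm F)\<^sup>2"
    by (subst (asm) ennreal_le_iff) auto
  then have "cmod (g 0) \<le> norm F"
    by (rule power2_le_imp_le) simp
  moreover have "cmod (g 0) = exp (- ((cmod w)\<^sup>2 / 2)) * cmod (apply_fock F w)"
    by (simp add: g_def fock_shift_def norm_mult norm_exp_eq_Re)
  ultimately show ?thesis
    by (simp add: exp_minus field_simps)
qed

lemma norm_fock_shift_le: "cmod (fock_shift (apply_fock F) w u) \<le> exp ((cmod u)\<^sup>2 / 2) * norm F"
proof (rule power2_le_imp_le)
  have "(cmod (apply_fock F (w + u)))\<^sup>2 \<le> (exp ((cmod (w + u))\<^sup>2 / 2) * norm F)\<^sup>2"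
    by (intro power_mono norm_apply_fock_le) auto
  also have "\<dots> = exp ((cmod (w + u))\<^sup>2) * (norm F)\<^sup>2"
    by (simp add: power_mult_distrib flip: exp_of_nat_mult)
  finally have "exp (- (cmod (w + u))\<^sup>2) * (cmod (apply_fock F (w + u)))\<^sup>2 \<le> (norm F)\<^sup>2"
    by (simp add: exp_minus field_simps)
  then have "(cmod (fock_shift (apply_fock F) w u))\<^sup>2 \<le> exp ((cmod u)\<^sup>2) * (norm F)\<^sup>2"
    by (simp add: norm_fock_shift)
  also have "\<dots> = (exp ((cmod u)\<^sup>2 / 2) * norm F)\<^sup>2"
    by (simp add: power_mult_distrib flip: exp_of_nat_mult)
  finally show "(cmod (fock_shift (apply_fock F) w u))\<^sup>2 \<le> (exp ((cmod u)\<^sup>2 / 2) * norm F)\<^sup>2" .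
qed auto

section \<open>The orthogonal projection\<close>

text \<open>The pointwise bound makes a norm-bounded sequence locally uniformly bounded, so Montel's
  theorem applies, and Fatou keeps the limit in the ball. This takes the place of weak sequential
  compactness of balls.\<close>

lemma fock_Montel:
  fixes F :: "nat \<Rightarrow> fock"
  assumes bd: "\<And>n. norm (F n) \<le> C"
  obtains G r where "strict_mono (r :: nat \<Rightarrow> nat)" "norm G \<le> C"
    "\<And>z. (\<lambda>n. apply_fock (F (r n)) z) \<longlonglongrightarrow> apply_fock G z"
    "\<And>K. compact K \<Longrightarrow> uniform_limit K (\<lambda>n. apply_fock (F (r n))) (apply_fock G) sequentially"
proof -
  have C: "C \<ge> 0" using bd[of 0] norm_ge_zero[of "F 0"] by linarith
  obtain g r where g: "g holomorphic_on UNIV" "strict_mono (r :: nat \<Rightarrow> nat)"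
    "\<And>x. x \<in> UNIV \<Longrightarrow> (\<lambda>n. apply_fock (F (r n)) x) \<longlonglongrightarrow> g x"
    "\<And>K. compact K \<Longrightarrow> K \<subseteq> UNIV \<Longrightarrow> uniform_limit K ((\<lambda>n. apply_fock (F n)) \<circ> r) g sequentially"
  proof (rule Montel)
    show "open (UNIV :: complex set)" by simp
    show "range (\<lambda>n. apply_fock (F n)) \<subseteq> range (\<lambda>n. apply_fock (F n))" by simp
    show "h holomorphic_on UNIV" if "h \<in> range (\<lambda>n. apply_fock (F n))" for h
      using that by (auto simp: apply_fock_holomorphic)
    fix K :: "complex set" assume "compact K"
    then obtain B where B: "\<And>z. z \<in> K \<Longrightarrow> cmod z \<le> B"
      by (meson bounded_iff compact_imp_bounded)
    show "\<exists>B. \<forall>h\<in>range (\<lambda>n. apply_fock (F n)). \<forall>z\<in>K. cmod (h z) \<le> B"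
    proof (intro exI ballI)
      fix h z assume "h \<in> range (\<lambda>n. apply_fock (F n))" and z: "z \<in> K"
      then obtain n where "h = apply_fock (F n)" by auto
      then have "cmod (h z) \<le> exp ((cmod z)\<^sup>2 / 2) * norm (F n)"
        by (simp add: norm_apply_fock_le)
      also have "\<dots> \<le> exp (B\<^sup>2 / 2) * C"
        using B[OF z] bd[of n] by (intro mult_mono) (auto intro!: power_mono)
      finally show "cmod (h z) \<le> exp (B\<^sup>2 / 2) * C" .
    qed
  qed blast
  have [measurable]: "g \<in> borel_measurable borel" using g(1) by (rule entire_measurable)
  have "(\<integral>\<^sup>+z. ennreal (exp (- (cmod z)\<^sup>2) * (cmod (g z))\<^sup>2) \<partial>lborel)
      = (\<integral>\<^sup>+z. liminf (\<lambda>n. ennreal (exp (- (cmod z)\<^sup>2) * (cmod (apply_fock (F (r n)) z))\<^sup>2)) \<partial>lborel)"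
    using g(3) by (intro nn_integral_cong lim_imp_Liminf[symmetric] tendsto_ennrealI tendsto_intros) auto
  also have "\<dots> \<le> liminf (\<lambda>n. \<integral>\<^sup>+z. ennreal (exp (- (cmod z)\<^sup>2) * (cmod (apply_fock (F (r n)) z))\<^sup>2) \<partial>lborel)"
    by (rule nn_integral_liminf) measurable
  also have "\<dots> = liminf (\<lambda>n. ennreal (pi * (norm (F (r n)))\<^sup>2))"
    by (simp add: nn_integral_apply_fock)
  also have "\<dots> \<le> liminf (\<lambda>n. ennreal (pi * C\<^sup>2))"
    by (intro Liminf_mono always_eventually allI ennreal_leI mult_left_mono power_mono bd) auto
  also have "\<dots> = ennreal (pi * C\<^sup>2)"
    by (simp add: Liminf_const)
  finally have G: "g \<in> fock_space" "norm (Abs_fock g) \<le> C"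
    using fock_spaceI[OF g(1) _ C] by auto
  show ?thesis
    using that[OF g(2) G(2)] g(3,4) by (simp add: Abs_fock_inverse[OF G(1)] o_def)
qed

lemma square_integrable_diff_fock:
  assumes "square_integrable g"
  shows "square_integrable (\<lambda>z. g z - apply_fock h z)"
  using square_integrable_add[OF assms square_integrable_mult_const[OF apply_fock_square_integrable[of h], of "-1"]]
  by simp

text \<open>A minimising sequence has a locally uniformly convergent subsequence, and Fatou's lemma
  shows that its limit is a minimiser; so completeness of the Fock space is not needed.\<close>

lemma fock_nearest_point:
  assumes g: "square_integrable g"
  obtains H where "\<And>h. (LINT z|gauss. (cmod (g z - apply_fock H z))\<^sup>2) \<le> (LINT z|gauss. (cmod (g z - apply_fock h z))\<^sup>2)"
proof -
  define D where "D = (\<lambda>h. LINT z|gauss. (cmod (g z - apply_fock h z))\<^sup>2)"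
  define d where "d = (INF h. D h)"
  have D0: "D h \<ge> 0" for h by (simp add: D_def)
  have bdd: "bdd_below (range D)" using D0 by (intro bdd_belowI[of _ 0]) auto
  have d0: "d \<ge> 0" unfolding d_def by (rule cINF_greatest) (auto simp: D0)
  have dD: "d \<le> D h" for h unfolding d_def by (rule cINF_lower[OF bdd]) simp
  have [measurable]: "g \<in> borel_measurable gauss"
    using g by (simp add: square_integrable_def)
  have int: "integrable gauss (\<lambda>z. (cmod (g z - apply_fock h z))\<^sup>2)" for h
    using square_integrable_diff_fock[OF g] by (simp add: square_integrable_def)
  have "\<exists>h. D h < d + 1 / real (Suc n)" for n
  proof -
    have "d < d + 1 / real (Suc n)" by simp
    then show ?thesis
      unfolding d_def by (subst (asm) cINF_less_iff[OF _ bdd]) auto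
  qed
  then obtain h where h: "\<And>n. D (h n) < d + 1 / real (Suc n)" by metis
  have lim: "(\<lambda>n. D (h n)) \<longlonglongrightarrow> d"
  proof (rule tendsto_sandwich[of "\<lambda>_. d" _ _ "\<lambda>n. d + 1 / real (Suc n)"])
    show "(\<lambda>n. d + 1 / real (Suc n)) \<longlonglongrightarrow> d"
      using tendsto_add[OF tendsto_const LIMSEQ_inverse_real_of_nat, of d] by (simp add: inverse_eq_divide)
    show "\<forall>\<^sub>F n in sequentially. D (h n) \<le> d + 1 / real (Suc n)"
      using h by (intro always_eventually allI less_imp_le)
  qed (use dD in auto)
  define N where "N = (LINT z|gauss. (cmod (g z))\<^sup>2)"
  have N: "N \<ge> 0" by (simp add: N_def)
  \<comment> \<open>Near-minimisers are bounded: their squared distance to \<open>g\<close> is below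
    \<open>d + 1\<close>, and \<open>(x + y)\<^sup>2\<close> is at most
    \<open>2 * x\<^sup>2 + 2 * y\<^sup>2\<close>.\<close>
  have "norm (h n) \<le> sqrt (2 * (d + 1) + 2 * N)" for n
  proof (rule real_le_rsqrt)
    have "(norm (h n))\<^sup>2 = (LINT z|gauss. (cmod (apply_fock (h n) z))\<^sup>2)"
      by (simp add: norm_fock_eq)
    also have "\<dots> \<le> (LINT z|gauss. 2 * (cmod (g z - apply_fock (h n) z))\<^sup>2 + 2 * (cmod (g z))\<^sup>2)"
    proof (rule integral_mono)
      show "integrable gauss (\<lambda>z. (cmod (apply_fock (h n) z))\<^sup>2)"
        using apply_fock_square_integrable by (simp add: square_integrable_def)
      show "integrable gauss (\<lambda>z. 2 * (cmod (g z - apply_fock (h n) z))\<^sup>2 + 2 * (cmod (g z))\<^sup>2)"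
        using int[of "h n"] g by (simp add: square_integrable_def)
      fix z
      let ?a = "cmod (g z - apply_fock (h n) z)" and ?b = "cmod (g z)"
      have "cmod (apply_fock (h n) z) \<le> ?a + ?b"
        using norm_triangle_ineq4[of "g z" "g z - apply_fock (h n) z"] by simp
      then have "(cmod (apply_fock (h n) z))\<^sup>2 \<le> (?a + ?b)\<^sup>2"
        by (rule power_mono) simp
      also have "\<dots> \<le> 2 * ?a\<^sup>2 + 2 * ?b\<^sup>2"
        using zero_le_power2[of "?a - ?b"] by (simp add: power2_sum power2_diff)
      finally show "(cmod (apply_fock (h n) z))\<^sup>2 \<le> 2 * ?a\<^sup>2 + 2 * ?b\<^sup>2" .
    qed
    also have "\<dots> = 2 * D (h n) + 2 * N"
      unfolding D_def N_def using int[of "h n"] g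
      by (subst Bochner_Integration.integral_add) (simp_all add: square_integrable_def)
    also have "\<dots> \<le> 2 * (d + 1) + 2 * N"
    proof -
      have "d + 1 / real (Suc n) \<le> d + 1" by simp
      with h[of n] have "D (h n) < d + 1" by (rule less_le_trans)
      then show ?thesis by simp
    qed
    finally show "(norm (h n))\<^sup>2 \<le> 2 * (d + 1) + 2 * N" .
  qed
  then obtain H r where r: "strict_mono (r :: nat \<Rightarrow> nat)"
    and H: "\<And>z. (\<lambda>n. apply_fock (h (r n)) z) \<longlonglongrightarrow> apply_fock H z"
    using fock_Montel[of h "sqrt (2 * (d + 1) + 2 * N)"] by metis
  have nn: "(\<integral>\<^sup>+z. ennreal ((cmod (g z - apply_fock k z))\<^sup>2) \<partial>gauss) = ennreal (D k)" for k
    unfolding D_def using int by (subst nn_integral_eq_integral) auto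
  have "ennreal (D H) = (\<integral>\<^sup>+z. liminf (\<lambda>n. ennreal ((cmod (g z - apply_fock (h (r n)) z))\<^sup>2)) \<partial>gauss)"
    unfolding nn[symmetric]
    using H by (intro nn_integral_cong lim_imp_Liminf[symmetric] tendsto_ennrealI tendsto_intros) auto
  also have "\<dots> \<le> liminf (\<lambda>n. \<integral>\<^sup>+z. ennreal ((cmod (g z - apply_fock (h (r n)) z))\<^sup>2) \<partial>gauss)"
    by (rule nn_integral_liminf) measurable
  also have "\<dots> = liminf (\<lambda>n. ennreal (D (h (r n))))"
    by (simp add: nn)
  also have "\<dots> = ennreal d"
    using LIMSEQ_subseq_LIMSEQ[OF lim r]
    by (intro lim_imp_Liminf tendsto_ennrealI) (auto simp: o_def)
  finally have "D H \<le> d"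
    using d0 by simp
  then have "D H \<le> D k" for k using dD[of k] by simp
  then show ?thesis using that[of H] unfolding D_def by blast
qed

text \<open>Since \<open>fock_proj\<close> is a definite description, a projection has to be
  exhibited before anything can be said about it. It is the nearest point \<open>H\<close>:
  minimality along each real line \<open>H + t *\<^sub>R k\<close> makes the residual orthogonal to
  the space.\<close>

lemma l2_inner_fock_proj:
  assumes g: "square_integrable g"
  shows "l2_inner g (apply_fock k) = fock_inner (fock_proj g) k"
proof -
  obtain H where H: "\<And>h. (LINT z|gauss. (cmod (g z - apply_fock H z))\<^sup>2) \<le> (LINT z|gauss. (cmod (g z - apply_fock h z))\<^sup>2)"
    using fock_nearest_point[OF g] by blast
  define a where "a = (\<lambda>z. g z - apply_fock H z)"
  have a: "square_integrable a" unfolding a_def by (rule square_integrable_diff_fock[OF g])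
  have Re0: "Re (l2_inner a (apply_fock k)) = 0" for k
  proof (rule ccontr)
    define R where "R = Re (l2_inner a (apply_fock k))"
    assume "Re (l2_inner a (apply_fock k)) \<noteq> 0"
    then have R: "R \<noteq> 0" by (simp add: R_def)
    have ia: "integrable gauss (\<lambda>z. (cmod (a z))\<^sup>2)" and ik: "integrable gauss (\<lambda>z. (cmod (apply_fock k z))\<^sup>2)"
      using a apply_fock_square_integrable by (auto simp: square_integrable_def)
    have ip: "integrable gauss (\<lambda>z. a z * cnj (apply_fock k z))"
      by (rule integrable_l2_inner[OF a apply_fock_square_integrable])
    define q where "q = (\<lambda>z. Re (a z * cnj (apply_fock k z)))"
    have iq: "integrable gauss q" and Rq: "(LINT z|gauss. q z) = R"
      using ip unfolding q_def R_def l2_inner_def by (auto simp del: times_complex.sel)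
    have ineq: "2 * t * R \<le> t\<^sup>2 * (norm k)\<^sup>2" for t :: real
    proof -
      have "(cmod (g z - apply_fock (H + t *\<^sub>R k) z))\<^sup>2
        = (cmod (a z))\<^sup>2 + t\<^sup>2 * (cmod (apply_fock k z))\<^sup>2 - 2 * t * q z" for z
        by (simp add: q_def a_def plus_fock.rep_eq scaleR_fock.rep_eq cmod_power2) (simp add: power2_eq_square algebra_simps)
      then have "(LINT z|gauss. (cmod (g z - apply_fock (H + t *\<^sub>R k) z))\<^sup>2)
          = (LINT z|gauss. (cmod (a z))\<^sup>2) + t\<^sup>2 * (LINT z|gauss. (cmod (apply_fock k z))\<^sup>2) - 2 * t * R"
        unfolding Rq[symmetric] using ia ik iq by simp
      then show ?thesis
        using H[of "H + t *\<^sub>R k"] by (simp add: norm_fock_eq a_def)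
    qed
    show False
    proof (cases "norm k = 0")
      case True
      then show ?thesis using ineq[of R] R by (auto simp: mult_le_0_iff)
    next
      case False
      then have n: "(norm k)\<^sup>2 > 0" by simp
      \<comment> \<open>The minimiser in \<open>t\<close> of
        \<open>t\<^sup>2 * (norm k)\<^sup>2 - 2 * t * R\<close>, where this quadratic is
        negative.\<close>
      define s where "s = R / (norm k)\<^sup>2"
      have Rs: "R = s * (norm k)\<^sup>2" and "s \<noteq> 0" using n R by (auto simp: s_def)
      have "2 * (s\<^sup>2 * (norm k)\<^sup>2) \<le> s\<^sup>2 * (norm k)\<^sup>2"
        using ineq[of s] unfolding Rs by (simp add: power2_eq_square mult.assoc)
      moreover have "s\<^sup>2 * (norm k)\<^sup>2 > 0" using n \<open>s \<noteq> 0\<close> by simp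
      ultimately show ?thesis by linarith
    qed
  qed
  have orth: "l2_inner a (apply_fock k) = 0" for k
  proof (rule complex_eqI)
    show "Re (l2_inner a (apply_fock k)) = Re 0" using Re0 by simp
    \<comment> \<open>Conjugate linearity in the second argument turns the imaginary part for
      \<open>k\<close> into the real part for \<open>\<i> k\<close>.\<close>
    have "l2_inner a (apply_fock (scaleC_fock \<i> k)) = - \<i> * l2_inner a (apply_fock k)"
      by (simp add: l2_inner_def scaleC_fock.rep_eq mult.left_commute)
    then show "Im (l2_inner a (apply_fock k)) = Im 0"
      using Re0[of "scaleC_fock \<i> k"] by simp
  qed
  have "fock_proj g = H"
    by (rule fock_proj_eqI[OF g]) (use orth in \<open>simp add: a_def\<close>)
  moreover have "l2_inner g (apply_fock k) = l2_inner a (apply_fock k) + fock_inner H k"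
    unfolding fock_inner_def l2_inner_def
    by (subst Bochner_Integration.integral_add[symmetric,
          OF integrable_l2_inner[OF a apply_fock_square_integrable]
             integrable_l2_inner[OF apply_fock_square_integrable apply_fock_square_integrable]])
       (simp add: a_def algebra_simps)
  ultimately show ?thesis using orth by simp
qed

section \<open>Gaussian growth\<close>

text \<open>Suppose \<open>\<phi> z = c 0 + c 1 * z + z ^ N * g z\<close> with \<open>N \<ge> 2\<close> and \<open>l = g 0 \<noteq> 0\<close> (after moving \<open>z0\<close> to \<open>0\<close>).
  For \<open>h z = l * z ^ N\<close> we have \<open>(cmod (\<phi> z))\<^sup>2 \<ge> 2 * Re (\<phi> z * cnj h) - (cmod h)\<^sup>2\<close>, and on a circle around \<open>0\<close>
  the function \<open>Re (\<phi> z * cnj h)\<close> agrees with the real part of an entire function \<open>H\<close>. The maximum principle for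
  \<open>\<psi> * exp H\<close> then contradicts the growth bound; no Jensen formula for the zeros of \<open>\<psi>\<close> is needed.\<close>

lemma affine_of_gaussian_growth:
  fixes \<psi> \<phi> :: "complex \<Rightarrow> complex"
  assumes \<psi>: "\<psi> holomorphic_on UNIV" and \<phi>: "\<phi> holomorphic_on UNIV"
    and le: "\<And>z. cmod (\<psi> z) * exp ((cmod (\<phi> z))\<^sup>2 / 2) \<le> C * exp ((cmod z)\<^sup>2 / 2)"
    and ne: "\<psi> z0 \<noteq> 0"
  obtains a b where "\<And>z. \<phi> z = a * z + b"
proof -
  have C: "C > 0"
  proof -
    have "0 < cmod (\<psi> z0) * exp ((cmod (\<phi> z0))\<^sup>2 / 2)" using ne by simp
    then have "0 < C * exp ((cmod z0)\<^sup>2 / 2)" using le[of z0] by linarith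
    then show ?thesis by (simp add: zero_less_mult_iff)
  qed
  define f where "f = (\<lambda>z. \<phi> (z + z0))"
  define p where "p = (\<lambda>z. \<psi> (z + z0))"
  have f: "f holomorphic_on UNIV" and p: "p holomorphic_on UNIV"
    unfolding f_def p_def
    by (auto intro!: holomorphic_intros holomorphic_on_compose_gen[OF _ \<phi>, unfolded o_def] holomorphic_on_compose_gen[OF _ \<psi>, unfolded o_def])
  have p0: "p 0 \<noteq> 0" using ne by (simp add: p_def)
  have f_sums: "(\<lambda>n. (deriv ^^ n) f 0 / fact n * z ^ n) sums f z" for z
    using holomorphic_power_series[of f 0 "cmod z + 1" z] f holomorphic_on_subset by fastforce
  define c where "c = (\<lambda>n. (deriv ^^ n) f 0 / fact n)"
  have c0: "c n = 0" if "n \<ge> 2" for n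
  proof (rule ccontr)
    assume "c n \<noteq> 0"
    define N where "N = (LEAST n. 2 \<le> n \<and> c n \<noteq> 0)"
    have N: "2 \<le> N \<and> c N \<noteq> 0"
      unfolding N_def by (rule LeastI[of _ n]) (use that \<open>c n \<noteq> 0\<close> in auto)
    have cN: "c k = 0" if "2 \<le> k" "k < N" for k
      using not_less_Least[of k "\<lambda>n. 2 \<le> n \<and> c n \<noteq> 0"] that unfolding N_def by blast
    \<comment> \<open>The value at 0 fills the removable singularity, so that \<open>g\<close> is
      the sum of the shifted power series on the whole plane.\<close>
    define g where "g = (\<lambda>z. if z = 0 then c N else (f z - c 0 - c 1 * z) / z ^ N)"
    have g_sums: "(\<lambda>k. c (k + N) * z ^ k) sums g z" for z
    proof (cases "z = 0")
      case True
      then show ?thesis using powser_sums_zero[of "\<lambda>k. c (k + N)"] by (simp add: g_def)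
    next
      case False
      have "(\<lambda>k. c (k + N) * z ^ (k + N)) sums (f z - (\<Sum>k<N. c k * z ^ k))"
        using sums_split_initial_segment[OF f_sums[of z], of N] by (simp add: c_def)
      also have "(\<Sum>k<N. c k * z ^ k) = (\<Sum>k<2. c k * z ^ k)"
        using N cN by (intro sum.mono_neutral_right) auto
      also have "\<dots> = c 0 + c 1 * z"
        by (simp add: numeral_2_eq_2)
      finally have "(\<lambda>k. c (k + N) * z ^ (k + N) / z ^ N) sums ((f z - (c 0 + c 1 * z)) / z ^ N)"
        by (rule sums_divide)
      then show ?thesis using False by (simp add: g_def power_add algebra_simps)
    qed
    have gh: "g holomorphic_on UNIV"
    proof -
      have "g field_differentiable at z" for z
      proof (rule holomorphic_on_imp_differentiable_at)
        show "g holomorphic_on ball 0 (cmod z + 1)"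
          by (rule power_series_holomorphic[where a = "\<lambda>k. c (k + N)"]) (use g_sums in simp)
      qed auto
      then show ?thesis
        by (simp add: holomorphic_on_def field_differentiable_at_within)
    qed
    have fg: "f z = c 0 + c 1 * z + z ^ N * g z" for z
    proof (cases "z = 0")
      case True
      then show ?thesis using N by (simp add: c_def)
    qed (simp add: g_def)
    define l where "l = g 0"
    have l: "l \<noteq> 0" using N by (simp add: l_def g_def)
    \<comment> \<open>The gain is a factor 2: the exponent at the centre is
      \<open>(cmod l)\<^sup>2 * r ^ (2 * N)\<close>, while completing the square on the boundary
      costs only half of it.\<close>
    have key: "cmod (p 0) * exp ((cmod l)\<^sup>2 * r ^ (2 * N)) \<le> C * exp ((r + cmod z0)\<^sup>2 / 2 + (cmod l)\<^sup>2 * r ^ (2 * N) / 2)"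
      if r: "r > 0" for r :: real
    proof -
      \<comment> \<open>On the circle, \<open>z * cnj z = r\<^sup>2\<close> makes the term of
        \<open>f z * cnj h\<close> containing \<open>g\<close> holomorphic. The terms from
        \<open>c 0\<close> and \<open>c 1\<close> are replaced by their conjugates, which have the
        same real part and become polynomials in \<open>z\<close>. As \<open>N - 1 > 0\<close>,
        these polynomials vanish at 0.\<close>
      define H where "H = (\<lambda>z. cnj l * of_real (r ^ (2 * N)) * g z + l * (cnj (c 0) * z ^ N + cnj (c 1) * of_real (r\<^sup>2) * z ^ (N - 1)))"
      have H: "H holomorphic_on UNIV"
        unfolding H_def by (intro holomorphic_intros gh)
      have H0: "H 0 = of_real ((cmod l)\<^sup>2 * r ^ (2 * N))"
      proof -
        have "H 0 = (cnj l * l) * of_real (r ^ (2 * N))"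
          using N by (simp add: H_def l_def power_0_left)
        then show ?thesis by (simp add: complex_norm_square mult.commute del: of_real_power)
      qed
      have "cmod (p 0 * exp (H 0)) \<le> C * exp ((r + cmod z0)\<^sup>2 / 2 + (cmod l)\<^sup>2 * r ^ (2 * N) / 2)"
      proof (rule maximum_modulus_frontier[of "\<lambda>z. p z * exp (H z)" "ball 0 r"])
        show "(\<lambda>z. p z * exp (H z)) holomorphic_on interior (ball 0 r)"
          using p H by (intro holomorphic_intros) (auto intro: holomorphic_on_subset)
        show "continuous_on (closure (ball 0 r)) (\<lambda>z. p z * exp (H z))"
          by (intro continuous_intros) (auto intro: holomorphic_on_imp_continuous_on holomorphic_on_subset[OF p] holomorphic_on_subset[OF H])
        show "bounded (ball (0::complex) r)" by simp
        show "0 \<in> ball 0 r" using r by simp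
        fix z :: complex assume "z \<in> frontier (ball 0 r)"
        then have z: "cmod z = r" using r by (simp add: frontier_ball)
        define h where "h = l * z ^ N"
        have zz: "z * cnj z = of_real (r\<^sup>2)" using z by (simp add: complex_norm_square[symmetric])
        have z1: "z ^ N * cnj z ^ N = of_real (r ^ (2 * N))"
          by (simp add: zz power_mult flip: power_mult_distrib)
        have z2: "z ^ N * cnj z = of_real (r\<^sup>2) * z ^ (N - 1)"
          using N zz by (cases N) (auto simp: mult_ac)
        have "Re (f z * cnj h) = Re (c 0 * cnj l * cnj z ^ N) + Re (c 1 * cnj l * (z * cnj z ^ N)) + Re (cnj l * (z ^ N * cnj z ^ N) * g z)"
          by (simp add: fg h_def algebra_simps)
        also have "Re (c 0 * cnj l * cnj z ^ N) = Re (l * cnj (c 0) * z ^ N)"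
          by (subst complex_cnj_cnj[symmetric], subst cnj.simps(1)) (simp add: mult_ac)
        also have "Re (c 1 * cnj l * (z * cnj z ^ N)) = Re (l * cnj (c 1) * (z ^ N * cnj z))"
          by (subst complex_cnj_cnj[symmetric], subst cnj.simps(1)) (simp add: mult_ac)
        finally have Re: "Re (f z * cnj h) = Re (H z)"
          unfolding z1 z2 by (simp add: H_def algebra_simps)
        have "0 \<le> (cmod (f z - h))\<^sup>2" by simp
        also have "\<dots> = (cmod (f z))\<^sup>2 + (cmod h)\<^sup>2 - 2 * Re (f z * cnj h)"
          by (simp add: cmod_power2 power2_diff algebra_simps)
        finally have "Re (H z) \<le> (cmod (f z))\<^sup>2 / 2 + (cmod h)\<^sup>2 / 2"
          unfolding Re by linarith
        moreover have "(cmod h)\<^sup>2 = (cmod l)\<^sup>2 * r ^ (2 * N)"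
          by (simp add: h_def norm_mult norm_power z power_mult_distrib power_even_eq power_mult mult.commute flip: power_mult)
        ultimately have "Re (H z) \<le> (cmod (f z))\<^sup>2 / 2 + (cmod l)\<^sup>2 * r ^ (2 * N) / 2" by simp
        then have "cmod (p z * exp (H z)) \<le> cmod (p z) * exp ((cmod (f z))\<^sup>2 / 2 + (cmod l)\<^sup>2 * r ^ (2 * N) / 2)"
          by (simp add: norm_mult mult_left_mono)
        also have "\<dots> = (cmod (p z) * exp ((cmod (f z))\<^sup>2 / 2)) * exp ((cmod l)\<^sup>2 * r ^ (2 * N) / 2)"
          by (simp add: exp_add)
        also have "\<dots> \<le> (C * exp ((cmod (z + z0))\<^sup>2 / 2)) * exp ((cmod l)\<^sup>2 * r ^ (2 * N) / 2)"
          unfolding p_def f_def by (intro mult_right_mono le) auto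
        also have "\<dots> \<le> (C * exp ((r + cmod z0)\<^sup>2 / 2)) * exp ((cmod l)\<^sup>2 * r ^ (2 * N) / 2)"
          using C norm_triangle_ineq[of z z0] z by (intro mult_right_mono mult_left_mono) (auto intro!: power_mono)
        finally show "cmod (p z * exp (H z)) \<le> C * exp ((r + cmod z0)\<^sup>2 / 2 + (cmod l)\<^sup>2 * r ^ (2 * N) / 2)"
          by (simp add: exp_add)
      qed
      then show ?thesis by (simp add: H0 norm_mult flip: of_real_mult of_real_power)
    qed
    define A where "A = (cmod l)\<^sup>2"
    have A: "A > 0" using l by (simp add: A_def)
    define D where "D = ln (C / cmod (p 0))"
    \<comment> \<open>Here \<open>N \<ge> 2\<close> is decisive: \<open>r ^ (2 * N)\<close>
      dominates \<open>r ^ 4\<close>, which outgrows the quadratic right-hand side.\<close>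
    have bound: "A * r ^ 4 \<le> (r + cmod z0)\<^sup>2 + 2 * D" if r: "r \<ge> 1" for r :: real
    proof -
      have "cmod (p 0) * exp (A * r ^ (2 * N)) \<le> C * exp ((r + cmod z0)\<^sup>2 / 2 + A * r ^ (2 * N) / 2)"
        using key[of r] r by (simp add: A_def)
      also have "C = cmod (p 0) * exp D"
        using C p0 by (simp add: D_def)
      finally have "exp (A * r ^ (2 * N)) \<le> exp (D + ((r + cmod z0)\<^sup>2 / 2 + A * r ^ (2 * N) / 2))"
        using p0 by (simp add: exp_add mult.assoc)
      then have "A * r ^ (2 * N) \<le> (r + cmod z0)\<^sup>2 + 2 * D" by simp
      moreover have "A * r ^ 4 \<le> A * r ^ (2 * N)"
        using A N r by (intro mult_left_mono power_increasing) auto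
      ultimately show ?thesis by linarith
    qed
    have "eventually (\<lambda>r. A * r ^ 4 > (r + cmod z0)\<^sup>2 + 2 * D) at_top"
      using A by real_asymp
    then obtain r where "r \<ge> 1" "A * r ^ 4 > (r + cmod z0)\<^sup>2 + 2 * D"
      using eventually_happens[OF eventually_conj[OF eventually_ge_at_top[of 1]]] by fastforce
    then show False using bound[of r] by simp
  qed
  have "f z = c 0 + c 1 * z" for z
  proof -
    have "(\<lambda>n. c n * z ^ n) sums (\<Sum>n<2. c n * z ^ n)"
      using c0 by (intro sums_finite) auto
    then have "f z = (\<Sum>n<2. c n * z ^ n)"
      using f_sums[of z] sums_unique2 unfolding c_def by blast
    then show ?thesis by (simp add: numeral_2_eq_2)
  qed
  then have "\<phi> z = c 1 * z + (c 0 - c 1 * z0)" for z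
    by (metis (no_types, lifting) f_def add.commute diff_add_cancel add_diff_eq right_diff_distrib)
  then show ?thesis using that by blast
qed

section \<open>Commutators with Weyl operators\<close>

lemma apply_fock_scaleC: "apply_fock (scaleC_fock c F) w = c * apply_fock F w"
  by (simp add: scaleC_fock.rep_eq)

lemma apply_fock_weyl: "apply_fock (blinfun_apply (weyl_op z) F) w = normalized_kernel z w * apply_fock F (w - z)"
  by (simp add: weyl_op.rep_eq weyl_fock.rep_eq)

lemma fock_eqI: "(\<And>w. apply_fock F w = apply_fock G w) \<Longrightarrow> F = G"
  by (simp add: fun_eq_iff flip: apply_fock_inject)

lemma norm_weyl_apply [simp]: "norm (blinfun_apply (weyl_op z) F) = norm F"
  using weyl_isometry(2)[OF apply_fock_holomorphic, of F z] apply_fock_square_integrable[of F]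
  by (simp add: norm_fock_eq apply_fock_weyl square_integrable_def)

lemma norm_weyl_op_le: "norm (weyl_op z) \<le> 1"
  by (rule norm_blinfun_bound) auto

lemma normalized_kernel_weyl_inverse: "normalized_kernel z w * normalized_kernel (- z) (w - z) = 1"
proof -
  have "w * cnj z - complex_of_real ((cmod z)\<^sup>2 / 2) + ((w - z) * cnj (- z) - complex_of_real ((cmod (- z))\<^sup>2 / 2)) = 0"
    using complex_norm_square[of z] by (simp add: algebra_simps)
  then show ?thesis
    unfolding normalized_kernel_def exp_add[symmetric] by (simp only: exp_zero)
qed

lemma weyl_op_inverse: "blinfun_apply (weyl_op z) (blinfun_apply (weyl_op (- z)) F) = F"
  by (rule fock_eqI)
     (simp add: apply_fock_weyl normalized_kernel_weyl_inverse flip: mult.assoc)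

text \<open>By polarisation the isometry \<open>weyl_op z\<close> preserves the real inner product,
  so its inverse \<open>weyl_op (- z)\<close> is its adjoint.\<close>

lemma inner_weyl_left:
  "inner (blinfun_apply (weyl_op z) F) G = inner F (blinfun_apply (weyl_op (- z)) G)"
proof -
  have polar: "inner x y = ((norm (x + y))\<^sup>2 - (norm x)\<^sup>2 - (norm y)\<^sup>2) / 2" for x y :: fock
    by (simp add: power2_norm_eq_inner inner_add_left inner_add_right inner_commute)
  have "inner (blinfun_apply (weyl_op z) F) (blinfun_apply (weyl_op z) H) = inner F H" for H
    unfolding polar by (simp flip: blinfun.add_right)
  from this[of "blinfun_apply (weyl_op (- z)) G"] show ?thesis
    by (simp add: weyl_op_inverse)
qed

text \<open>This separates a unimodular phase, which oscillates rapidly for large \<open>w\<close>,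
  from a Gaussian size and from a recentred factor whose dependence on \<open>z\<close> holomorphy
  controls.\<close>

lemma weyl_apply_eq_fock_shift:
  "apply_fock (blinfun_apply (weyl_op z) F) w
    = exp (w * cnj z - z * cnj w) * of_real (exp ((cmod w)\<^sup>2 / 2 - (cmod z)\<^sup>2 / 2)) * fock_shift (apply_fock F) w (- z)"
proof -
  have "normalized_kernel z w = exp ((w * cnj z - z * cnj w) + of_real ((cmod w)\<^sup>2 / 2 - (cmod z)\<^sup>2 / 2)
      + (- (- z) * cnj w - of_real ((cmod w)\<^sup>2 / 2)))"
    by (simp add: normalized_kernel_def)
  then show ?thesis
    unfolding exp_add by (simp add: apply_fock_weyl fock_shift_def mult.assoc flip: exp_of_real)
qed

lemma apply_fock_eq_fock_shift:
  "apply_fock F w = of_real (exp ((cmod w)\<^sup>2 / 2)) * fock_shift (apply_fock F) w 0"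
  by (simp add: fock_shift_def exp_diff exp_minus flip: exp_of_real)

lemma norm_exp_phase [simp]: "cmod (exp (w * cnj z - z * cnj w)) = 1"
  by (simp add: norm_exp_eq_Re)

lemma fock_shift_measurable [measurable]:
  "(\<lambda>w. fock_shift (apply_fock F) w u) \<in> borel_measurable borel"
  unfolding fock_shift_def
  by (intro borel_measurable_continuous_onI continuous_intros
        continuous_on_compose2[OF holomorphic_on_imp_continuous_on[OF apply_fock_holomorphic]]) auto

lemma fock_shift_increment_le:
  assumes "cmod u \<le> 1/2"
  shows "cmod (fock_shift (apply_fock F) w u - fock_shift (apply_fock F) w 0) \<le> 2 * exp (1/2) * cmod u * norm F"
proof -
  let ?g = "fock_shift (apply_fock F) w"
  have "ennreal ((cmod (?g u - ?g 0))\<^sup>2) \<le> ennreal (4 * (cmod u)\<^sup>2) * (\<integral>\<^sup>+t\<in>{0..1}. ennreal ((cmod (?g (circ t)))\<^sup>2) \<partial>lborel)"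
    by (rule square_increment_le[OF fock_shift_holomorphic[OF apply_fock_holomorphic] assms])
  also have "(\<integral>\<^sup>+t\<in>{0..1}. ennreal ((cmod (?g (circ t)))\<^sup>2) \<partial>lborel) \<le> (\<integral>\<^sup>+t\<in>{0..1::real}. ennreal ((exp (1/2) * norm F)\<^sup>2) \<partial>lborel)"
  proof (rule nn_integral_mono)
    fix t
    have "cmod (?g (circ t)) \<le> exp (1/2) * norm F"
      using norm_fock_shift_le[of F w "circ t"] by simp
    then show "ennreal ((cmod (?g (circ t)))\<^sup>2) * indicator {0..1} t \<le> ennreal ((exp (1/2) * norm F)\<^sup>2) * indicator {0..1} t"
      by (intro mult_right_mono ennreal_leI power_mono) auto
  qed
  also have "\<dots> = ennreal ((exp (1/2) * norm F)\<^sup>2)"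
    by (subst nn_integral_cmult) auto
  finally have "ennreal ((cmod (?g u - ?g 0))\<^sup>2) \<le> ennreal (4 * (cmod u)\<^sup>2 * (exp (1/2) * norm F)\<^sup>2)"
    by (simp add: mult_left_mono flip: ennreal_mult)
  then have "(cmod (?g u - ?g 0))\<^sup>2 \<le> 4 * (cmod u)\<^sup>2 * (exp (1/2) * norm F)\<^sup>2"
    by (subst (asm) ennreal_le_iff) auto
  also have "\<dots> = (2 * exp (1/2) * cmod u * norm F)\<^sup>2"
    by (simp add: power_mult_distrib)
  finally show ?thesis by (rule power2_le_imp_le) auto
qed

text \<open>After Fubini the inner integral runs over the centre \<open>w\<close> at the fixed
  offset \<open>circ t\<close>; its value is the same for all \<open>t\<close>, and
  \<open>exp 1\<close> arises from \<open>cmod (circ t) = 1\<close>.\<close>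

lemma nn_integral_fock_shift_increment:
  assumes "cmod u \<le> 1/2"
  shows "(\<integral>\<^sup>+w. ennreal ((cmod (fock_shift (apply_fock F) w u - fock_shift (apply_fock F) w 0))\<^sup>2) \<partial>lborel)
    \<le> ennreal (4 * (cmod u)\<^sup>2 * (exp 1 * pi * (norm F)\<^sup>2))"
proof -
  let ?g = "fock_shift (apply_fock F)"
  have [measurable]: "circ \<in> borel_measurable borel"
    by (intro borel_measurable_continuous_onI continuous_circ)
  have [measurable]: "(\<lambda>(w, t). ennreal ((cmod (?g w (circ t)))\<^sup>2)) \<in> borel_measurable (lborel \<Otimes>\<^sub>M lborel)"
    unfolding norm_fock_shift by measurable
  have "(\<integral>\<^sup>+w. ennreal ((cmod (?g w u - ?g w 0))\<^sup>2) \<partial>lborel)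
    \<le> (\<integral>\<^sup>+w. ennreal (4 * (cmod u)\<^sup>2) * (\<integral>\<^sup>+t\<in>{0..1}. ennreal ((cmod (?g w (circ t)))\<^sup>2) \<partial>lborel) \<partial>lborel)"
    by (intro nn_integral_mono square_increment_le fock_shift_holomorphic apply_fock_holomorphic assms)
  also have "\<dots> = ennreal (4 * (cmod u)\<^sup>2) * (\<integral>\<^sup>+w. (\<integral>\<^sup>+t\<in>{0..1}. ennreal ((cmod (?g w (circ t)))\<^sup>2) \<partial>lborel) \<partial>lborel)"
    by (rule nn_integral_cmult) measurable
  also have "(\<integral>\<^sup>+w. (\<integral>\<^sup>+t\<in>{0..1}. ennreal ((cmod (?g w (circ t)))\<^sup>2) \<partial>lborel) \<partial>lborel)
     = (\<integral>\<^sup>+t. (\<integral>\<^sup>+w. ennreal ((cmod (?g w (circ t)))\<^sup>2) * indicator {0..1} t \<partial>lborel) \<partial>lborel)"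
    by (rule lborel_pair.Fubini') measurable
  also have "\<dots> = (\<integral>\<^sup>+t. ennreal (exp 1 * pi * (norm F)\<^sup>2) * indicator {0..1::real} t \<partial>lborel)"
    by (rule nn_integral_cong, subst nn_integral_multc) (auto simp: nn_integral_fock_shift)
  also have "\<dots> = ennreal (exp 1 * pi * (norm F)\<^sup>2)"
    by (subst nn_integral_cmult) auto
  finally show ?thesis by (simp flip: ennreal_mult)
qed

lemma nn_integral_mult_le_sqrt:
  fixes f g :: "'a \<Rightarrow> ennreal"
  assumes [measurable]: "f \<in> borel_measurable M" "g \<in> borel_measurable M"
    and f: "(\<integral>\<^sup>+x. (f x)\<^sup>2 \<partial>M) \<le> ennreal (a\<^sup>2)" and g: "(\<integral>\<^sup>+x. (g x)\<^sup>2 \<partial>M) \<le> ennreal (b\<^sup>2)"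
    and "a \<ge> 0" "b \<ge> 0"
  shows "(\<integral>\<^sup>+x. f x * g x \<partial>M) \<le> ennreal (a * b)"
proof -
  have "(\<integral>\<^sup>+x. f x * g x \<partial>M)\<^sup>2 \<le> (\<integral>\<^sup>+x. (f x)\<^sup>2 \<partial>M) * (\<integral>\<^sup>+x. (g x)\<^sup>2 \<partial>M)"
    by (rule Cauchy_Schwarz_nn_integral) measurable
  also have "\<dots> \<le> ennreal (a\<^sup>2) * ennreal (b\<^sup>2)"
    by (intro mult_mono f g) auto
  also have "\<dots> = ennreal ((a * b)\<^sup>2)"
    by (simp add: power_mult_distrib ennreal_mult)
  finally have le: "(\<integral>\<^sup>+x. f x * g x \<partial>M)\<^sup>2 \<le> ennreal ((a * b)\<^sup>2)" .
  show ?thesis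
  proof (cases "\<integral>\<^sup>+x. f x * g x \<partial>M" rule: ennreal_cases)
    case (real r)
    then have "r\<^sup>2 \<le> (a * b)\<^sup>2"
      using le by (simp add: ennreal_power)
    then have "r \<le> a * b"
      by (rule power2_le_imp_le) (use assms in simp)
    then show ?thesis using real by (simp add: ennreal_leI)
  next
    case top
    then show ?thesis using le by (simp add: top_unique power2_eq_square)
  qed
qed

section \<open>Commutators with Weyl operators, and their size for Toeplitz operators\<close>

definition weyl_commutator :: "(fock \<Rightarrow>\<^sub>L fock) \<Rightarrow> complex \<Rightarrow> (fock \<Rightarrow>\<^sub>L fock)" where
  "weyl_commutator A z = (A o\<^sub>L weyl_op z) - (weyl_op z o\<^sub>L A)"

lemma weyl_commutator_apply:
  "blinfun_apply (weyl_commutator A z) F = blinfun_apply A (blinfun_apply (weyl_op z) F) - blinfun_apply (weyl_op z) (blinfun_apply A F)"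
  unfolding weyl_commutator_def blinfun.diff_left blinfun_apply_blinfun_compose ..

text \<open>Testing with \<open>g\<close> equal to \<open>T f\<close> turns a one-sided bound on a
  real form into a bound on the operator norm.\<close>

lemma norm_blinfun_inner_bound:
  fixes T :: "'a::real_normed_vector \<Rightarrow>\<^sub>L 'b::real_inner"
  assumes "\<And>f g. inner (blinfun_apply T f) g \<le> K * norm f * norm g" "K \<ge> 0"
  shows "norm T \<le> K"
proof (rule norm_blinfun_bound)
  fix f
  have "norm (blinfun_apply T f) * norm (blinfun_apply T f) \<le> (K * norm f) * norm (blinfun_apply T f)"
    using assms(1)[of f "blinfun_apply T f"] by (simp add: power2_norm_eq_inner[symmetric] power2_eq_square)
  then show "norm (blinfun_apply T f) \<le> K * norm f"
    by (cases "norm (blinfun_apply T f) = 0") (use assms(2) in \<open>auto dest: mult_right_le_imp_le\<close>)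
qed (rule assms)

lemma inner_weyl_commutator:
  "inner (blinfun_apply (weyl_commutator A z) F) G
    = inner (blinfun_apply A (blinfun_apply (weyl_op z) F)) G - inner (blinfun_apply A F) (blinfun_apply (weyl_op (- z)) G)"
  by (simp add: weyl_commutator_apply inner_diff_left inner_weyl_left)

lemma square_integrable_ess_bounded_mult:
  assumes f: "ess_bounded f" and g: "square_integrable g"
  shows "square_integrable (\<lambda>z. f z * g z)"
proof -
  obtain C where C: "AE z in lborel. cmod (f z) \<le> C" and [measurable]: "f \<in> borel_measurable gauss"
    using f by (auto simp: ess_bounded_def)
  have [measurable]: "g \<in> borel_measurable gauss" using g by (simp add: square_integrable_def)
  have "integrable gauss (\<lambda>z. C\<^sup>2 * (cmod (g z))\<^sup>2)"
    using g by (simp add: square_integrable_def)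
  then have "integrable gauss (\<lambda>z. (cmod (f z * g z))\<^sup>2)"
  proof (rule Bochner_Integration.integrable_bound)
    have "AE z in gauss. cmod (f z) \<le> C" using C by (simp add: AE_gauss_iff)
    then show "AE z in gauss. norm ((cmod (f z * g z))\<^sup>2) \<le> norm (C\<^sup>2 * (cmod (g z))\<^sup>2)"
      by eventually_elim (auto simp: norm_mult power_mult_distrib intro!: mult_right_mono power_mono)
  qed measurable
  then show ?thesis by (simp add: square_integrable_def)
qed

text \<open>Moving one Weyl operator to the other side leaves the integral of \<open>f * D\<close>,
  in which the symbol enters through its bound alone. Both products in \<open>D\<close> have the
  same phase; without it, \<open>D\<close> is a combination of two increments of recentred entire
  functions. Each increment contributes \<open>2 * exp (1/2) * cmod z\<close>.\<close>

lemma norm_weyl_commutator_toeplitz: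
  assumes f: "ess_bounded f" and C: "AE z in lborel. cmod (f z) \<le> C" "C \<ge> 0"
    and A: "\<And>g. blinfun_apply A g = fock_proj (\<lambda>z. f z * apply_fock g z)"
    and z: "cmod z \<le> 1/2"
  shows "norm (weyl_commutator A z) \<le> C * 4 * exp (1/2) * cmod z"
proof (rule norm_blinfun_inner_bound)
  fix g h
  let ?g = "fock_shift (apply_fock g)" and ?h = "fock_shift (apply_fock h)"
  let ?Ug = "apply_fock (blinfun_apply (weyl_op z) g)" and ?Uh = "apply_fock (blinfun_apply (weyl_op (- z)) h)"
  define D where "D = (\<lambda>w. ?Ug w * cnj (apply_fock h w) - apply_fock g w * cnj (?Uh w))"
  have [measurable]: "f \<in> borel_measurable borel" using f by (simp add: ess_bounded_def)
  have [measurable]: "cnj \<in> borel_measurable borel"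
    by (intro borel_measurable_continuous_onI continuous_intros)
  have [measurable]: "D \<in> borel_measurable borel" unfolding D_def by measurable
  have A_inner: "inner (blinfun_apply A k) l = Re (l2_inner (\<lambda>z. f z * apply_fock k z) (apply_fock l))"
    and int: "integrable gauss (\<lambda>z. f z * apply_fock k z * cnj (apply_fock l z))" for k l
    using square_integrable_ess_bounded_mult[OF f apply_fock_square_integrable[of k]]
    by (auto simp: inner_fock_def A l2_inner_fock_proj intro: integrable_l2_inner apply_fock_square_integrable)
  have "inner (blinfun_apply (weyl_commutator A z) g) h = Re (LINT w|gauss. f w * D w)"
    unfolding inner_weyl_commutator A_inner l2_inner_def minus_complex.sel(1)[symmetric]
    by (subst Bochner_Integration.integral_diff[OF int int, symmetric]) (simp add: D_def algebra_simps)
  also have "\<dots> \<le> cmod (LINT w|gauss. f w * D w)" by (rule complex_Re_le_cmod)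
  finally have "ennreal (inner (blinfun_apply (weyl_commutator A z) g) h) \<le> ennreal (cmod (LINT w|gauss. f w * D w))"
    by (rule ennreal_leI)
  also have "\<dots> \<le> (\<integral>\<^sup>+w. ennreal (cmod (f w * D w)) \<partial>gauss)"
    by (rule integral_norm_bound_ennreal) 
      (use Bochner_Integration.integrable_diff[OF int int, of "blinfun_apply (weyl_op z) g" h g "blinfun_apply (weyl_op (- z)) h"] in 
        \<open>simp add: D_def algebra_simps\<close>)
  also have "\<dots> \<le> (\<integral>\<^sup>+w. ennreal (C * cmod (D w)) \<partial>gauss)"
  proof (rule nn_integral_mono_AE)
    have "AE w in gauss. cmod (f w) \<le> C" using C by (simp add: AE_gauss_iff)
    then show "AE w in gauss. ennreal (cmod (f w * D w)) \<le> ennreal (C * cmod (D w))"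
      by eventually_elim (auto simp: norm_mult intro!: ennreal_leI mult_right_mono)
  qed
  finally have "ennreal pi * ennreal (inner (blinfun_apply (weyl_commutator A z) g) h)
     \<le> ennreal pi * (\<integral>\<^sup>+w. ennreal (C * cmod (D w)) \<partial>gauss)"
    by (rule mult_left_mono) simp
  also have "\<dots> = (\<integral>\<^sup>+w. ennreal (exp (- (cmod w)\<^sup>2) * (C * cmod (D w))) \<partial>lborel)"
    using C by (intro nn_integral_gauss) auto
  also have "\<dots> \<le> (\<integral>\<^sup>+w. ennreal C * (ennreal (cmod (?g w (- z) - ?g w 0)) * ennreal (cmod (?h w 0))
      + ennreal (cmod (?h w z - ?h w 0)) * ennreal (cmod (?g w 0))) \<partial>lborel)"
  proof (rule nn_integral_mono)
    fix w
    let ?e = "exp ((cmod w)\<^sup>2 / 2)" and ?p = "exp (w * cnj z - z * cnj w)" and ?q = "exp (- (cmod z)\<^sup>2 / 2)"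
    have e: "exp (- (cmod w)\<^sup>2) * (?e * ?e) = 1"
      by (simp flip: exp_add)
    have "D w = of_real (?e * ?e) * (?p * of_real ?q * (?g w (- z) * cnj (?h w 0) - ?g w 0 * cnj (?h w z)))"
    proof -
      \<comment> \<open>Negating \<open>z\<close> and conjugating each reverse the purely imaginary
        exponent, so together they restore the phase \<open>?p\<close>.\<close>
      have "cnj (exp (w * cnj (- z) - (- z) * cnj w)) = ?p"
        by (simp add: exp_cnj mult.commute)
      moreover have eq: "exp ((cmod w)\<^sup>2 / 2 - (cmod z)\<^sup>2 / 2) = ?e * ?q"
        by (simp flip: exp_add)
      ultimately have Uh: "cnj (?Uh w) = ?p * of_real (?e * ?q) * cnj (?h w z)"
        unfolding weyl_apply_eq_fock_shift by (simp add: eq)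
      have Ug: "?Ug w = ?p * of_real (?e * ?q) * ?g w (- z)"
        unfolding weyl_apply_eq_fock_shift eq ..
      have h: "cnj (apply_fock h w) = of_real ?e * cnj (?h w 0)"
        by (subst apply_fock_eq_fock_shift) simp
      have "D w = ?p * of_real (?e * ?q) * ?g w (- z) * (of_real ?e * cnj (?h w 0))
          - of_real ?e * ?g w 0 * (?p * of_real (?e * ?q) * cnj (?h w z))"
        unfolding D_def Uh Ug h by (subst apply_fock_eq_fock_shift) (rule refl)
      then show ?thesis
        unfolding of_real_mult by algebra
    qed
    then have "exp (- (cmod w)\<^sup>2) * cmod (D w)
        = (exp (- (cmod w)\<^sup>2) * (?e * ?e)) * (?q * cmod (?g w (- z) * cnj (?h w 0) - ?g w 0 * cnj (?h w z)))"
      by (simp add: norm_mult)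
    also have "\<dots> \<le> cmod (?g w (- z) * cnj (?h w 0) - ?g w 0 * cnj (?h w z))"
      unfolding e by (simp add: mult_left_le_one_le)
    \<comment> \<open>Adding and subtracting the product of the two values at offset 0 isolates one
      increment in each term.\<close>
    also have "?g w (- z) * cnj (?h w 0) - ?g w 0 * cnj (?h w z)
        = (?g w (- z) - ?g w 0) * cnj (?h w 0) - ?g w 0 * cnj (?h w z - ?h w 0)"
      by (simp add: algebra_simps)
    also have "cmod \<dots> \<le> cmod (?g w (- z) - ?g w 0) * cmod (?h w 0) + cmod (?h w z - ?h w 0) * cmod (?g w 0)"
      by (rule order_trans[OF norm_triangle_ineq4]) (simp add: norm_mult mult.commute flip: complex_cnj_diff)
    finally have "C * (exp (- (cmod w)\<^sup>2) * cmod (D w)) \<le> C * (cmod (?g w (- z) - ?g w 0) * cmod (?h w 0) + cmod (?h w z - ?h w 0) * cmod (?g w 0))"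
      using C(2) by (rule mult_left_mono)
    then show "ennreal (exp (- (cmod w)\<^sup>2) * (C * cmod (D w))) \<le> ennreal C * (ennreal (cmod (?g w (- z) - ?g w 0)) * ennreal (cmod (?h w 0))
      + ennreal (cmod (?h w z - ?h w 0)) * ennreal (cmod (?g w 0)))"
      using C by (simp add: ennreal_leI mult_ac flip: ennreal_mult ennreal_plus)
  qed
  also have "\<dots> = ennreal C * ((\<integral>\<^sup>+w. ennreal (cmod (?g w (- z) - ?g w 0)) * ennreal (cmod (?h w 0)) \<partial>lborel)
      + (\<integral>\<^sup>+w. ennreal (cmod (?h w z - ?h w 0)) * ennreal (cmod (?g w 0)) \<partial>lborel))"
    by (subst nn_integral_cmult, measurable) (subst nn_integral_add, auto)
  also have "\<dots> \<le> ennreal C * (ennreal ((2 * exp (1/2) * sqrt pi * cmod z * norm g) * (sqrt pi * norm h))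
      + ennreal ((2 * exp (1/2) * sqrt pi * cmod z * norm h) * (sqrt pi * norm g)))"
  proof (intro mult_left_mono add_mono nn_integral_mult_le_sqrt)
    have eq: "(2 * exp (1/2) * sqrt pi * cmod z * norm k)\<^sup>2 = 4 * (cmod z)\<^sup>2 * (exp 1 * pi * (norm k)\<^sup>2)" for k :: fock
      by (simp add: power_mult_distrib flip: exp_of_nat_mult)
    show "(\<integral>\<^sup>+w. (ennreal (cmod (?g w (- z) - ?g w 0)))\<^sup>2 \<partial>lborel) \<le> ennreal ((2 * exp (1/2) * sqrt pi * cmod z * norm g)\<^sup>2)"
      unfolding eq using nn_integral_fock_shift_increment[of "- z" g] z by (simp add: ennreal_power)
    show "(\<integral>\<^sup>+w. (ennreal (cmod (?h w z - ?h w 0)))\<^sup>2 \<partial>lborel) \<le> ennreal ((2 * exp (1/2) * sqrt pi * cmod z * norm h)\<^sup>2)"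
      unfolding eq using nn_integral_fock_shift_increment[of z h] z by (simp add: ennreal_power)
    show "(\<integral>\<^sup>+w. (ennreal (cmod (?g w 0)))\<^sup>2 \<partial>lborel) \<le> ennreal ((sqrt pi * norm g)\<^sup>2)"
      using nn_integral_fock_shift[of g 0] by (simp add: ennreal_power power_mult_distrib)
    show "(\<integral>\<^sup>+w. (ennreal (cmod (?h w 0)))\<^sup>2 \<partial>lborel) \<le> ennreal ((sqrt pi * norm h)\<^sup>2)"
      using nn_integral_fock_shift[of h 0] by (simp add: ennreal_power power_mult_distrib)
  qed auto
  also have "\<dots> = ennreal (C * ((2 * exp (1/2) * sqrt pi * cmod z * norm g) * (sqrt pi * norm h) + (2 * exp (1/2) * sqrt pi * cmod z * norm h) * (sqrt pi * norm g)))"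
    using C by (simp flip: ennreal_mult ennreal_plus)
  also have "C * ((2 * exp (1/2) * sqrt pi * cmod z * norm g) * (sqrt pi * norm h) + (2 * exp (1/2) * sqrt pi * cmod z * norm h) * (sqrt pi * norm g))
      = (sqrt pi * sqrt pi) * (C * 4 * exp (1/2) * cmod z * norm g * norm h)"
    by (simp add: algebra_simps del: real_sqrt_mult_self)
  also have "sqrt pi * sqrt pi = pi" by simp
  finally have "ennreal (pi * inner (blinfun_apply (weyl_commutator A z) g) h) \<le> ennreal (pi * (C * 4 * exp (1/2) * cmod z * norm g * norm h))"
    by (simp add: ennreal_mult')
  then show "inner (blinfun_apply (weyl_commutator A z) g) h \<le> C * 4 * exp (1/2) * cmod z * norm g * norm h"
    using C by (subst (asm) ennreal_le_iff) (auto simp: mult_nonneg_nonneg)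
qed (use C in auto)

section \<open>The algebra of Weyl-continuous operators\<close>

text \<open>Complex linearity as a family of commutation relations: closedness in norm then follows
  from continuity of composition.\<close>

lemma fock_operators_iff: "A \<in> fock_operators \<longleftrightarrow> (\<forall>c. A o\<^sub>L mult_op c = mult_op c o\<^sub>L A)"
  by (auto simp: fock_operators_def blinfun_apply_inject[symmetric] fun_eq_iff mult_op.rep_eq)

lemma weyl_op_mult_op: "weyl_op z o\<^sub>L mult_op c = mult_op c o\<^sub>L weyl_op z"
  by (rule blinfun_eqI, rule fock_eqI) (simp add: mult_op.rep_eq apply_fock_weyl apply_fock_scaleC)

lemma mult_op_commute: "mult_op c o\<^sub>L mult_op d = mult_op d o\<^sub>L mult_op c"
  by (rule blinfun_eqI, rule fock_eqI) (simp add: mult_op.rep_eq apply_fock_scaleC)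

lemma closed_fock_operators: "closed fock_operators"
proof -
  have "fock_operators = (\<Inter>c. {A. A o\<^sub>L mult_op c = mult_op c o\<^sub>L A})"
    by (auto simp: fock_operators_iff)
  also have "closed \<dots>"
    by (intro closed_INT ballI closed_Collect_eq continuous_intros)
  finally show ?thesis .
qed

text \<open>As \<open>weyl_op z\<close> is unitary, the condition says that the conjugates
  \<open>W\<^sub>z A W\<^sub>-\<^sub>z\<close> tend to \<open>A\<close> in norm as \<open>z\<close>
  tends to 0.\<close>

definition weyl_continuous :: "(fock \<Rightarrow>\<^sub>L fock) set" where
  "weyl_continuous = {A \<in> fock_operators. (weyl_commutator A \<longlongrightarrow> 0) (at 0)}"

lemma weyl_commutator_add: "weyl_commutator (A + B) z = weyl_commutator A z + weyl_commutator B z"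
  by (rule blinfun_eqI) (simp add: weyl_commutator_apply blinfun.add_left blinfun.add_right)

text \<open>Taking commutators is a derivation; this yields closure of
  \<open>weyl_continuous\<close> under products.\<close>

lemma weyl_commutator_compose:
  "weyl_commutator (A o\<^sub>L B) z = (A o\<^sub>L weyl_commutator B z) + (weyl_commutator A z o\<^sub>L B)"
  by (rule blinfun_eqI) (simp add: weyl_commutator_apply blinfun.add_left blinfun.diff_right)

lemma weyl_commutator_mult_op: "weyl_commutator (mult_op c) z = 0"
  using weyl_op_mult_op[of z c] by (simp add: weyl_commutator_def)

lemma norm_weyl_commutator_le: "norm (weyl_commutator A z) \<le> 2 * norm A"
proof -
  have "norm (weyl_commutator A z) \<le> norm (A o\<^sub>L weyl_op z) + norm (weyl_op z o\<^sub>L A)"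
    unfolding weyl_commutator_def by (rule norm_triangle_ineq4)
  also have "\<dots> \<le> norm A * norm (weyl_op z) + norm (weyl_op z) * norm A"
    by (intro add_mono norm_blinfun_compose)
  also have "\<dots> \<le> norm A * 1 + 1 * norm A"
    by (intro add_mono mult_mono norm_weyl_op_le) auto
  finally show ?thesis by simp
qed

text \<open>The adjoint of \<open>weyl_op z\<close> is \<open>weyl_op (- z)\<close>, hence the
  reflected parameter on the right; it is harmless because the filter at 0 is symmetric.\<close>

lemma norm_weyl_commutator_adjoint:
  assumes "is_adjoint A B"
  shows "norm (weyl_commutator B z) \<le> norm (weyl_commutator A (- z))"
proof (rule norm_blinfun_inner_bound)
  fix f g
  have adj: "inner (blinfun_apply B x) y = inner x (blinfun_apply A y)" for x y
    using assms by (metis inner_commute inner_fock_def is_adjoint_def)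
  have "inner (blinfun_apply (weyl_commutator B z) f) g = - inner f (blinfun_apply (weyl_commutator A (- z)) g)"
    by (simp add: weyl_commutator_apply inner_diff_left inner_diff_right adj inner_weyl_left)
  also have "\<dots> \<le> norm f * norm (blinfun_apply (weyl_commutator A (- z)) g)"
    using Cauchy_Schwarz_ineq2[of f "blinfun_apply (weyl_commutator A (- z)) g"] by simp
  also have "\<dots> \<le> norm f * (norm (weyl_commutator A (- z)) * norm g)"
    by (intro mult_left_mono norm_blinfun) auto
  finally show "inner (blinfun_apply (weyl_commutator B z) f) g \<le> norm (weyl_commutator A (- z)) * norm f * norm g"
    by (simp add: mult_ac)
qed auto

lemma closed_weyl_commutator_tendsto_0: "closed {A. (weyl_commutator A \<longlongrightarrow> 0) (at 0)}"
  unfolding closed_sequential_limits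
proof (intro allI impI CollectI tendstoI)
  fix A :: "nat \<Rightarrow> fock \<Rightarrow>\<^sub>L fock" and L :: "fock \<Rightarrow>\<^sub>L fock" and e :: real
  assume A: "(\<forall>n. A n \<in> {A. (weyl_commutator A \<longlongrightarrow> 0) (at 0)}) \<and> A \<longlonglongrightarrow> L" and e: "e > 0"
  \<comment> \<open>The commutator of \<open>L - A n\<close> costs at most
    \<open>2 * norm (L - A n)\<close>, so \<open>e / 4\<close> here leaves \<open>e / 2\<close> for
    that of \<open>A n\<close>.\<close>
  then obtain n where n: "norm (L - A n) < e / 4"
    using LIMSEQ_D[of A L "e / 4"] by (auto simp: norm_minus_commute)
  have "(weyl_commutator (A n) \<longlongrightarrow> 0) (at 0)"
    using A by auto
  then have "\<forall>\<^sub>F z in at 0. norm (weyl_commutator (A n) z) < e / 2"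
    using tendstoD[of "weyl_commutator (A n)" 0 "at 0" "e / 2"] e by simp
  then show "\<forall>\<^sub>F z in at 0. dist (weyl_commutator L z) 0 < e"
  proof eventually_elim
    case (elim z)
    have "weyl_commutator L z = weyl_commutator (A n) z + weyl_commutator (L - A n) z"
      by (simp flip: weyl_commutator_add)
    then have "norm (weyl_commutator L z) \<le> norm (weyl_commutator (A n) z) + norm (weyl_commutator (L - A n) z)"
      by (simp add: norm_triangle_ineq)
    with elim n norm_weyl_commutator_le[of "L - A n" z] show ?case by simp
  qed
qed

lemma weyl_continuous_compose:
  assumes "A \<in> fock_operators" "B \<in> fock_operators" 
    and A: "(weyl_commutator A \<longlongrightarrow> 0) (at 0)" and B: "(weyl_commutator B \<longlongrightarrow> 0) (at 0)"
  shows "A o\<^sub>L B \<in> weyl_continuous"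
proof -
  have "A o\<^sub>L B \<in> fock_operators"
    using assms(1,2) by (simp add: fock_operators_def)
  moreover have "((\<lambda>z. (A o\<^sub>L weyl_commutator B z) + (weyl_commutator A z o\<^sub>L B)) \<longlongrightarrow> (A o\<^sub>L 0) + (0 o\<^sub>L B)) (at 0)"
    by (intro tendsto_intros A B)
  ultimately show ?thesis
    by (simp add: weyl_continuous_def weyl_commutator_compose[abs_def])
qed

lemma cstar_subalgebra_weyl_continuous: "cstar_subalgebra weyl_continuous"
  unfolding cstar_subalgebra_def
proof (intro conjI ballI allI impI)
  show "weyl_continuous \<subseteq> fock_operators" by (auto simp: weyl_continuous_def)
  show "0 \<in> weyl_continuous"
    by (simp add: weyl_continuous_def fock_operators_iff weyl_commutator_def[abs_def])
  fix A assume A: "A \<in> weyl_continuous"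
  show "mult_op c o\<^sub>L A \<in> weyl_continuous" for c
    using A by (intro weyl_continuous_compose)
      (auto simp: weyl_continuous_def weyl_commutator_mult_op[abs_def] fock_operators_iff mult_op_commute)
  fix B
  show "A + B \<in> weyl_continuous" if "B \<in> weyl_continuous"
    using A that by (auto simp: weyl_continuous_def fock_operators_iff weyl_commutator_add[abs_def]
        bounded_bilinear.add_left[OF bounded_bilinear_blinfun_compose]
        bounded_bilinear.add_right[OF bounded_bilinear_blinfun_compose] intro: tendsto_add_zero)
  show "A o\<^sub>L B \<in> weyl_continuous" if "B \<in> weyl_continuous"
    using A that by (intro weyl_continuous_compose) (auto simp: weyl_continuous_def)
  show "B \<in> weyl_continuous" if B: "B \<in> fock_operators" "is_adjoint A B"
  proof -
    have "filterlim uminus (at (0::complex)) (at 0)"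
      by (auto simp: filterlim_at eventually_at_filter intro!: tendsto_eq_intros)
    moreover have "(weyl_commutator A \<longlongrightarrow> 0) (at 0)" using A by (simp add: weyl_continuous_def)
    ultimately have "((\<lambda>z. weyl_commutator A (- z)) \<longlongrightarrow> 0) (at 0)"
      by (rule filterlim_compose[rotated])
    then have "(weyl_commutator B \<longlongrightarrow> 0) (at 0)"
      by (rule tendsto_0_le[where K = 1]) (use norm_weyl_commutator_adjoint[OF B(2)] in simp)
    then show ?thesis using B by (simp add: weyl_continuous_def)
  qed
next
  have eq: "weyl_continuous = fock_operators \<inter> {A. (weyl_commutator A \<longlongrightarrow> 0) (at 0)}"
    by (auto simp: weyl_continuous_def)
  show "closed weyl_continuous"
    unfolding eq by (intro closed_Int closed_fock_operators closed_weyl_commutator_tendsto_0)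
qed

lemma toeplitz_operators_weyl_continuous: "toeplitz_operators \<subseteq> weyl_continuous"
proof
  fix A assume "A \<in> toeplitz_operators"
  then obtain f where A: "A \<in> fock_operators" and f: "ess_bounded f"
    and Af: "\<And>g. blinfun_apply A g = fock_proj (\<lambda>z. f z * apply_fock g z)"
    by (auto simp: toeplitz_operators_def)
  obtain C0 where "AE z in lborel. cmod (f z) \<le> C0" using f by (auto simp: ess_bounded_def)
  then have C: "AE z in lborel. cmod (f z) \<le> max C0 0"
    by eventually_elim auto
  have "(weyl_commutator A \<longlongrightarrow> 0) (at 0)"
  proof (rule tendsto_0_le)
    show "((\<lambda>z::complex. z) \<longlongrightarrow> 0) (at 0)" by (rule tendsto_ident_at)
    have "\<forall>\<^sub>F z::complex in at 0. cmod z < 1/2"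
      using tendstoD[OF tendsto_ident_at[of "0::complex" UNIV], of "1/2"] by simp
    then show "\<forall>\<^sub>F z in at 0. norm (weyl_commutator A z) \<le> norm z * (max C0 0 * 4 * exp (1/2))"
      by eventually_elim
        (use norm_weyl_commutator_toeplitz[OF f C _ Af] in \<open>simp add: mult_ac\<close>)
  qed
  then show "A \<in> weyl_continuous" using A by (simp add: weyl_continuous_def)
qed

lemma toeplitz_algebra_weyl_continuous: "toeplitz_algebra \<subseteq> weyl_continuous"
  unfolding toeplitz_algebra_def
  using cstar_subalgebra_weyl_continuous toeplitz_operators_weyl_continuous by blast

section \<open>Weighted composition operators\<close>

lemma fock_space_one: "(\<lambda>_. 1) \<in> fock_space" "norm (Abs_fock (\<lambda>_. 1)) \<le> 1"
  using fock_spaceI[of "\<lambda>_. 1" 1] by (auto simp: nn_integral_gaussian_complex)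

text \<open>Obtaining the kernel as a Weyl translate of the constant 1 gives membership and the norm
  bound from the isometry.\<close>

definition fock_kernel :: "complex \<Rightarrow> fock" where
  "fock_kernel p = blinfun_apply (weyl_op p) (Abs_fock (\<lambda>_. 1))"

lemma apply_fock_kernel: "apply_fock (fock_kernel p) w = normalized_kernel p w"
  by (simp add: fock_kernel_def apply_fock_weyl Abs_fock_inverse[OF fock_space_one(1)])

lemma norm_fock_kernel_le: "norm (fock_kernel p) \<le> 1"
  using fock_space_one(2) by (simp add: fock_kernel_def)

lemma normalized_kernel_self: "normalized_kernel p p = of_real (exp ((cmod p)\<^sup>2 / 2))"
proof -
  have "p * cnj p - of_real ((cmod p)\<^sup>2 / 2) = of_real ((cmod p)\<^sup>2 / 2)"
    unfolding complex_norm_square[symmetric] by (simp flip: of_real_diff)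
  then show ?thesis by (simp add: normalized_kernel_def flip: exp_of_real)
qed

lemma acts_as_weighted_comp:
  assumes "acts_as W (weighted_comp \<psi> \<phi>)"
  shows "apply_fock (blinfun_apply W F) w = \<psi> w * apply_fock F (\<phi> w)"
  using assms by (simp add: acts_as_def weighted_comp_def)

text \<open>The kernel at \<open>\<phi> w\<close> takes the value
  \<open>exp ((cmod (\<phi> w))\<^sup>2 / 2)\<close> there; the pointwise bound for its image at
  \<open>w\<close> does the rest.\<close>

lemma weighted_comp_growth:
  assumes W: "acts_as W (weighted_comp \<psi> \<phi>)"
  shows "cmod (\<psi> w) * exp ((cmod (\<phi> w))\<^sup>2 / 2) \<le> norm W * exp ((cmod w)\<^sup>2 / 2)"
proof -
  have "cmod (\<psi> w) * exp ((cmod (\<phi> w))\<^sup>2 / 2) = cmod (apply_fock (blinfun_apply W (fock_kernel (\<phi> w))) w)"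
    by (simp add: acts_as_weighted_comp[OF W] apply_fock_kernel normalized_kernel_self norm_mult)
  also have "\<dots> \<le> exp ((cmod w)\<^sup>2 / 2) * norm (blinfun_apply W (fock_kernel (\<phi> w)))"
    by (rule norm_apply_fock_le)
  also have "\<dots> \<le> exp ((cmod w)\<^sup>2 / 2) * (norm W * 1)"
    by (intro mult_left_mono order_trans[OF norm_blinfun] norm_fock_kernel_le) auto
  finally show ?thesis by (simp add: mult.commute)
qed

text \<open>Near the identity, \<open>W\<^sub>\<zeta>\<close> acts at a point \<open>w\<close> as multiplication by the phase
  \<open>exp (w * cnj \<zeta> - \<zeta> * cnj w)\<close>. When these phases are opposite at \<open>w\<close> and at \<open>\<phi> w\<close>,
  the commutator of \<open>W\<close> and \<open>W\<^sub>\<zeta>\<close> cannot be small unless the weight is.\<close>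

lemma weight_le_weyl_commutator:
  assumes W: "acts_as W (weighted_comp \<psi> \<phi>)" and \<zeta>: "cmod \<zeta> \<le> 1/2"
    and phase: "exp (\<phi> w * cnj \<zeta> - \<zeta> * cnj (\<phi> w)) = - exp (w * cnj \<zeta> - \<zeta> * cnj w)"
  shows "cmod (\<psi> w) * exp ((cmod (\<phi> w))\<^sup>2 / 2 - (cmod w)\<^sup>2 / 2)
    \<le> norm (weyl_commutator W \<zeta>) + exp (1/2) * cmod \<zeta> * norm W"
proof -
  define p where "p = \<phi> w"
  define F where "F = blinfun_apply W (fock_kernel p)"
  define s where "s = fock_shift (apply_fock F) w"
  define P where "P = exp (w * cnj \<zeta> - \<zeta> * cnj w)"
  let ?e = "exp ((cmod w)\<^sup>2 / 2)" and ?q = "exp (- (cmod \<zeta>)\<^sup>2 / 2)"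
  have normF: "norm F \<le> norm W"
    unfolding F_def using norm_blinfun[of W "fock_kernel p"] norm_fock_kernel_le[of p]
    by (meson mult_left_le norm_ge_zero order_trans)
  have s0: "of_real ?e * s 0 = \<psi> w * of_real (exp ((cmod p)\<^sup>2 / 2))"
    using apply_fock_eq_fock_shift[of F w]
    by (simp add: s_def F_def acts_as_weighted_comp[OF W] apply_fock_kernel normalized_kernel_self p_def)
  have norm_s0: "cmod (\<psi> w) * exp ((cmod (\<phi> w))\<^sup>2 / 2 - (cmod w)\<^sup>2 / 2) = cmod (s 0)"
  proof -
    have "cmod (\<psi> w) * exp ((cmod p)\<^sup>2 / 2) = ?e * cmod (s 0)"
      using arg_cong[OF s0, of cmod] by (simp add: norm_mult)
    then show ?thesis
      unfolding exp_diff times_divide_eq_right p_def by simp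
  qed
  have "normalized_kernel \<zeta> p * normalized_kernel p (p - \<zeta>)
      = exp (p * cnj \<zeta> - \<zeta> * cnj p) * exp (of_real (- (cmod \<zeta>)\<^sup>2 / 2)) * normalized_kernel p p"
    unfolding normalized_kernel_def exp_add[symmetric]
    by (rule arg_cong[where f = exp]) (simp add: algebra_simps)
  also have "\<dots> = - P * of_real ?q * of_real (exp ((cmod p)\<^sup>2 / 2))"
    using phase unfolding p_def P_def normalized_kernel_self by (simp only: exp_of_real)
  finally have kern: "normalized_kernel \<zeta> p * normalized_kernel p (p - \<zeta>) = - P * of_real ?q * of_real (exp ((cmod p)\<^sup>2 / 2))" .
  have "apply_fock (blinfun_apply W (blinfun_apply (weyl_op \<zeta>) (fock_kernel p))) w
      = \<psi> w * (normalized_kernel \<zeta> p * normalized_kernel p (p - \<zeta>))"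
    by (simp add: acts_as_weighted_comp[OF W] apply_fock_weyl apply_fock_kernel p_def)
  also have "\<dots> = - P * of_real ?q * (of_real ?e * s 0)"
    unfolding kern s0 by simp
  finally have 1: "apply_fock (blinfun_apply W (blinfun_apply (weyl_op \<zeta>) (fock_kernel p))) w
      = - (of_real ?e * of_real ?q * P * s 0)" by simp
  have 2: "apply_fock (blinfun_apply (weyl_op \<zeta>) F) w = of_real ?e * of_real ?q * P * s (- \<zeta>)"
  proof -
    have "exp ((cmod w)\<^sup>2 / 2 - (cmod \<zeta>)\<^sup>2 / 2) = ?e * ?q"
      by (simp flip: exp_add)
    then show ?thesis
      unfolding weyl_apply_eq_fock_shift s_def P_def by (simp only: of_real_mult mult_ac)
  qed
  \<comment> \<open>The opposite phases turn the difference in the commutator into a sum, close to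
    \<open>2 * s 0\<close> for small \<open>\<zeta>\<close> instead of cancelling.\<close>
  have "apply_fock (blinfun_apply (weyl_commutator W \<zeta>) (fock_kernel p)) w
      = - (of_real ?e * of_real ?q * P * (s 0 + s (- \<zeta>)))"
    unfolding weyl_commutator_apply minus_fock.rep_eq F_def[symmetric] 1 2 by algebra
  then have "?e * ?q * cmod (s 0 + s (- \<zeta>)) = cmod (apply_fock (blinfun_apply (weyl_commutator W \<zeta>) (fock_kernel p)) w)"
    by (simp only: norm_mult norm_minus_cancel norm_of_real abs_exp_cancel norm_exp_phase P_def mult_1_right)
  also have "\<dots> \<le> ?e * norm (blinfun_apply (weyl_commutator W \<zeta>) (fock_kernel p))"
    by (rule norm_apply_fock_le)
  also have "\<dots> \<le> ?e * (norm (weyl_commutator W \<zeta>) * 1)"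
    by (intro mult_left_mono order_trans[OF norm_blinfun] norm_fock_kernel_le) auto
  finally have qle: "?q * cmod (s 0 + s (- \<zeta>)) \<le> norm (weyl_commutator W \<zeta>)"
    by (simp add: mult.assoc)
  have "1 / 2 \<le> ?q"
  proof -
    have "(cmod \<zeta>)\<^sup>2 \<le> (1/2)\<^sup>2" using \<zeta> by (intro power_mono) auto
    then have "1 / 2 \<le> 1 + (- (cmod \<zeta>)\<^sup>2 / 2)" by (simp add: power2_eq_square)
    also have "\<dots> \<le> ?q" by (rule exp_ge_add_one_self)
    finally show ?thesis .
  qed
  then have "1 / 2 * cmod (s 0 + s (- \<zeta>)) \<le> ?q * cmod (s 0 + s (- \<zeta>))"
    by (rule mult_right_mono) simp
  with qle have le: "cmod (s 0 + s (- \<zeta>)) \<le> 2 * norm (weyl_commutator W \<zeta>)" by linarith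
  have "2 * cmod (s 0) = cmod ((s 0 + s (- \<zeta>)) - (s (- \<zeta>) - s 0))"
  proof -
    have "s 0 + s (- \<zeta>) - (s (- \<zeta>) - s 0) = 2 * s 0" by algebra
    then show ?thesis by (simp only: norm_mult norm_numeral)
  qed
  also have "\<dots> \<le> cmod (s 0 + s (- \<zeta>)) + cmod (s (- \<zeta>) - s 0)"
    by (rule norm_triangle_ineq4)
  also have "cmod (s (- \<zeta>) - s 0) \<le> 2 * exp (1/2) * cmod \<zeta> * norm F"
    using fock_shift_increment_le[of "- \<zeta>" F w] \<zeta> by (simp add: s_def)
  also have "\<dots> \<le> 2 * exp (1/2) * cmod \<zeta> * norm W"
    using normF by (intro mult_left_mono) auto
  finally show ?thesis unfolding norm_s0 using le by linarith
qed

text \<open>A displacement tending to infinity admits phase-reversing \<open>\<zeta> w\<close> that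
  tend to 0, where the commutator vanishes. Translations violate \<open>inf\<close>, since their
  displacement is constant.\<close>

lemma weight_tendsto_0:
  assumes W: "acts_as W (weighted_comp \<psi> \<phi>)" and comm: "(weyl_commutator W \<longlongrightarrow> 0) (at 0)"
    and inf: "filterlim (\<lambda>w. \<phi> w - w) at_infinity at_infinity"
  shows "((\<lambda>w. cmod (\<psi> w) * exp ((cmod (\<phi> w))\<^sup>2 / 2 - (cmod w)\<^sup>2 / 2)) \<longlongrightarrow> 0) at_infinity"
proof -
  \<comment> \<open>The purely imaginary solution of \<open>c * cnj \<zeta> = \<i> * pi / 2\<close>
    with \<open>c = \<phi> w - w\<close>, in the sense that this product is imaginary; the phase
    difference between \<open>\<phi> w\<close> and \<open>w\<close> is then
    \<open>\<i> * pi\<close>.\<close>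
  define \<zeta> where "\<zeta> = (\<lambda>w. - \<i> * of_real (pi / 2) * cnj (inverse (\<phi> w - w)))"
  have nz: "\<forall>\<^sub>F w in at_infinity. \<phi> w - w \<noteq> 0"
    using filterlim_at_infinity_imp_eventually_ne[OF inf] .
  have lim: "(\<zeta> \<longlongrightarrow> 0) at_infinity"
  proof -
    have "((\<lambda>w. inverse (\<phi> w - w)) \<longlongrightarrow> 0) at_infinity"
      by (rule filterlim_compose[OF tendsto_inverse_0 inf])
    from tendsto_mult[OF tendsto_const[of "- \<i> * of_real (pi / 2)"] tendsto_cnj[OF this]]
    show ?thesis unfolding \<zeta>_def by simp
  qed
  have "\<forall>\<^sub>F w in at_infinity. \<zeta> w \<in> UNIV \<and> \<zeta> w \<noteq> 0"
    using nz by (rule eventually_mono) (simp add: \<zeta>_def)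
  with lim have at0: "filterlim \<zeta> (at 0) at_infinity"
    unfolding filterlim_at by blast
  have "((\<lambda>w. norm (weyl_commutator W (\<zeta> w)) + exp (1/2) * cmod (\<zeta> w) * norm W) \<longlongrightarrow> norm (0 :: fock \<Rightarrow>\<^sub>L fock) + exp (1/2) * cmod 0 * norm W) at_infinity"
    by (rule tendsto_add[OF tendsto_norm[OF filterlim_compose[OF comm at0]]
          tendsto_mult[OF tendsto_mult[OF tendsto_const tendsto_norm[OF lim]] tendsto_const]])
  then have lim2: "((\<lambda>w. norm (weyl_commutator W (\<zeta> w)) + exp (1/2) * cmod (\<zeta> w) * norm W) \<longlongrightarrow> 0) at_infinity"
    by simp
  have "\<forall>\<^sub>F w in at_infinity. cmod (\<zeta> w) < 1/2"
    using tendstoD[OF lim, of "1/2"] by simp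
  with nz have "\<forall>\<^sub>F w in at_infinity. norm (cmod (\<psi> w) * exp ((cmod (\<phi> w))\<^sup>2 / 2 - (cmod w)\<^sup>2 / 2))
      \<le> norm (weyl_commutator W (\<zeta> w)) + exp (1/2) * cmod (\<zeta> w) * norm W"
  proof eventually_elim
    case (elim w)
    define c where "c = \<phi> w - w"
    have "c \<noteq> 0" using elim by (simp add: c_def)
    define d where "d = inverse c"
    have \<zeta>w: "\<zeta> w = - \<i> * of_real (pi / 2) * cnj d"
      unfolding \<zeta>_def d_def c_def ..
    have "c * cnj (\<zeta> w) - \<zeta> w * cnj c = \<i> * of_real (pi / 2) * (c * d) + \<i> * of_real (pi / 2) * cnj (c * d)"
      unfolding \<zeta>w complex_cnj_mult complex_cnj_cnj complex_cnj_minus complex_cnj_i complex_cnj_complex_of_real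
      by algebra
    also have "c * d = 1" using \<open>c \<noteq> 0\<close> by (simp add: d_def)
    finally have c\<zeta>: "c * cnj (\<zeta> w) - \<zeta> w * cnj c = \<i> * of_real pi"
      by simp
    have "\<phi> w * cnj (\<zeta> w) - \<zeta> w * cnj (\<phi> w) = (c * cnj (\<zeta> w) - \<zeta> w * cnj c) + (w * cnj (\<zeta> w) - \<zeta> w * cnj w)"
      unfolding c_def complex_cnj_diff by algebra
    then have "exp (\<phi> w * cnj (\<zeta> w) - \<zeta> w * cnj (\<phi> w)) = - exp (w * cnj (\<zeta> w) - \<zeta> w * cnj w)"
      unfolding c\<zeta> by (simp only: exp_add exp_pi_i' mult_minus1)
    with elim have "cmod (\<psi> w) * exp ((cmod (\<phi> w))\<^sup>2 / 2 - (cmod w)\<^sup>2 / 2)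
        \<le> norm (weyl_commutator W (\<zeta> w)) + exp (1/2) * cmod (\<zeta> w) * norm W"
      by (intro weight_le_weyl_commutator[OF W] less_imp_le)
    then show ?case
      by (simp only: real_norm_def abs_mult abs_norm_cancel abs_exp_cancel)
  qed
  then show ?thesis by (rule Lim_null_comparison) (rule lim2)
qed

section \<open>Compactness through locally uniformly null sequences\<close>

lemma compact_operatorI:
  assumes W: "\<And>g. (\<And>n. norm (g n) \<le> 2) \<Longrightarrow>
      (\<And>K. compact K \<Longrightarrow> uniform_limit K (\<lambda>n. apply_fock (g n)) (\<lambda>_. 0) sequentially) \<Longrightarrow>
      (\<lambda>n. blinfun_apply W (g n)) \<longlonglongrightarrow> 0"
  shows "compact_operator W"
proof -
  have "seq_compact (blinfun_apply W ` cball 0 1)"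
    unfolding seq_compact_def
  proof (intro allI impI)
    fix y assume "\<forall>n::nat. y n \<in> blinfun_apply W ` cball 0 1"
    then have "\<forall>n. \<exists>f. y n = blinfun_apply W f \<and> norm f \<le> 1"
      by (metis imageE mem_cball_0)
    then obtain f where f: "\<And>n. y n = blinfun_apply W (f n)" "\<And>n. norm (f n) \<le> 1" by metis
    obtain G r where r: "strict_mono (r :: nat \<Rightarrow> nat)" and G: "norm G \<le> 1"
      and lim: "\<And>K. compact K \<Longrightarrow> uniform_limit K (\<lambda>n. apply_fock (f (r n))) (apply_fock G) sequentially"
      using fock_Montel[of f 1] f(2) by metis
    \<comment> \<open>Subtracting the Montel limit produces a null sequence; the bound 2 allows for
      a difference of two elements of the unit ball.\<close>
    have "(\<lambda>n. blinfun_apply W (f (r n) - G)) \<longlonglongrightarrow> 0"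
    proof (rule W)
      show "norm (f (r n) - G) \<le> 2" for n
        using norm_triangle_ineq4[of "f (r n)" G] f(2)[of "r n"] G by linarith
      show "uniform_limit K (\<lambda>n. apply_fock (f (r n) - G)) (\<lambda>_. 0) sequentially" if "compact K" for K
        using uniform_limit_minus[OF lim[OF that] uniform_limit_const[of "apply_fock G" K sequentially]]
        by (simp add: minus_fock.rep_eq)
    qed
    then have "(y \<circ> r) \<longlonglongrightarrow> blinfun_apply W G"
      by (simp add: LIM_zero_iff f(1) blinfun.diff_right o_def)
    then show "\<exists>l\<in>blinfun_apply W ` cball 0 1. \<exists>r. strict_mono r \<and> (y \<circ> r) \<longlonglongrightarrow> l"
      using r G by (intro bexI[of _ "blinfun_apply W G"] exI[of _ r]) auto
  qed
  then have "compact (blinfun_apply W ` cball 0 1)"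
    by (simp add: compact_eq_seq_compact_metric)
  then show ?thesis
    by (simp add: compact_operator_def compact_imp_closed)
qed

lemma compact_weighted_comp_const:
  assumes \<psi>: "\<psi> \<in> fock_space" and W: "acts_as W (weighted_comp \<psi> (\<lambda>_. b))"
  shows "compact_operator W"
proof (rule compact_operatorI)
  fix g :: "nat \<Rightarrow> fock"
  assume lim: "\<And>K. compact K \<Longrightarrow> uniform_limit K (\<lambda>n. apply_fock (g n)) (\<lambda>_. 0) sequentially"
  \<comment> \<open>For constant \<open>\<phi>\<close> the operator has rank at most one: evaluation
    at \<open>b\<close> followed by multiplication of \<open>\<psi>\<close>.\<close>
  have eq: "blinfun_apply W F = scaleC_fock (apply_fock F b) (Abs_fock \<psi>)" for F
    by (rule fock_eqI) (simp add: acts_as_weighted_comp[OF W] apply_fock_scaleC Abs_fock_inverse[OF \<psi>])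
  have "(\<lambda>n. apply_fock (g n) b) \<longlonglongrightarrow> 0"
    using tendsto_uniform_limitI[OF lim[of "{b}"]] by simp
  then have "(\<lambda>n. norm (blinfun_apply W (g n))) \<longlonglongrightarrow> 0"
    unfolding eq norm_scaleC_fock by (intro tendsto_mult_left_zero tendsto_norm_zero)
  then show "(\<lambda>n. blinfun_apply W (g n)) \<longlonglongrightarrow> 0"
    by (rule tendsto_norm_zero_cancel)
qed

lemma nn_integral_lborel_complex_affine:
  fixes g :: "complex \<Rightarrow> ennreal"
  assumes [measurable]: "g \<in> borel_measurable borel" and "a \<noteq> 0"
  shows "(\<integral>\<^sup>+z. g (a * z + b) \<partial>lborel) = ennreal (1 / (cmod a)\<^sup>2) * (\<integral>\<^sup>+z. g z \<partial>lborel)"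
proof -
  have "(\<integral>\<^sup>+z. g (a * z + b) \<partial>lborel) = ennreal (1 / (cmod a)\<^sup>2) * (\<integral>\<^sup>+z. g (z + b) \<partial>lborel)"
    using nn_integral_lborel_complex_mult[of "\<lambda>z. g (z + b)" a] assms(2) by simp
  also have "(\<integral>\<^sup>+z. g (z + b) \<partial>lborel) = (\<integral>\<^sup>+z. g z \<partial>lborel)"
    using nn_integral_lborel_translate[of g b] by (simp add: add.commute)
  finally show ?thesis .
qed

text \<open>With the weight \<open>m w = cmod (\<psi> w) * exp ((cmod (\<phi> w))\<^sup>2 / 2 - (cmod w)\<^sup>2 / 2)\<close>, the squared norm of
  \<open>W f\<close> is the integral of \<open>(m w)\<^sup>2\<close> against \<open>(cmod (f u))\<^sup>2 * exp (- (cmod u)\<^sup>2) / pi\<close> at \<open>u = \<phi> w\<close>;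
  the contribution of large \<open>w\<close> is small because \<open>m\<close> is.\<close>

lemma compact_weighted_comp_affine:
  assumes W: "acts_as W (weighted_comp \<psi> (\<lambda>w. a * w + b))" and a: "a \<noteq> 0"
    and m0: "((\<lambda>w. cmod (\<psi> w) * exp ((cmod (a * w + b))\<^sup>2 / 2 - (cmod w)\<^sup>2 / 2)) \<longlongrightarrow> 0) at_infinity"
  shows "compact_operator W"
proof (rule compact_operatorI)
  fix g :: "nat \<Rightarrow> fock"
  assume g: "\<And>n. norm (g n) \<le> 2"
    and lim: "\<And>K. compact K \<Longrightarrow> uniform_limit K (\<lambda>n. apply_fock (g n)) (\<lambda>_. 0) sequentially"
  define \<phi> where "\<phi> = (\<lambda>w. a * w + b)"
  define m where "m = (\<lambda>w. cmod (\<psi> w) * exp ((cmod (\<phi> w))\<^sup>2 / 2 - (cmod w)\<^sup>2 / 2))"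
  have m_nonneg: "m w \<ge> 0" for w by (simp add: m_def)
  have m_le: "m w \<le> norm W" for w
    using weighted_comp_growth[OF W, of w] unfolding m_def \<phi>_def exp_diff
    by (simp add: divide_le_eq)
  have \<phi>_cont: "continuous_on S \<phi>" for S unfolding \<phi>_def by (intro continuous_intros)
  show "(\<lambda>n. blinfun_apply W (g n)) \<longlonglongrightarrow> 0"
  proof (rule tendstoI)
    fix e :: real assume e: "e > 0"
    \<comment> \<open>Chosen so that the far part contributes at most
      \<open>pi * e\<^sup>2 / 4\<close>, after the Jacobian \<open>1 / (cmod a)\<^sup>2\<close> and
      the bound \<open>norm (g n) \<le> 2\<close>.\<close>
    define \<epsilon> where "\<epsilon> = cmod a * e / 4"
    have \<epsilon>: "\<epsilon> > 0" using a e by (simp add: \<epsilon>_def)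
    have "\<forall>\<^sub>F w in at_infinity. m w < \<epsilon>"
      using tendstoD[OF m0 \<epsilon>] m_nonneg by (simp add: m_def \<phi>_def)
    then obtain R where R: "\<And>w. cmod w \<ge> R \<Longrightarrow> m w < \<epsilon>"
      by (auto simp: eventually_at_infinity)
    define V where "V = measure lborel (cball (0::complex) R)"
    have V: "V \<ge> 0" "emeasure lborel (cball (0::complex) R) = ennreal V"
      using emeasure_lborel_cball_finite[of "0::complex" R] by (auto simp: V_def emeasure_eq_ennreal_measure)
    \<comment> \<open>Chosen so that the part over the ball of radius \<open>R\<close>, where the
      weight is bounded only by \<open>norm W\<close>, contributes at most
      \<open>e\<^sup>2 / 4\<close>; the summand 1 keeps the denominator positive.\<close>
    define \<eta> where "\<eta> = e / (2 * sqrt ((norm W)\<^sup>2 * V + 1))"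
    have pos: "(norm W)\<^sup>2 * V + 1 > 0" using V by (simp add: add_nonneg_pos)
    have \<eta>: "\<eta> > 0" using e pos by (simp add: \<eta>_def)
    have \<eta>2: "(norm W)\<^sup>2 * \<eta>\<^sup>2 * V \<le> e\<^sup>2 / 4"
    proof -
      have "(norm W)\<^sup>2 * \<eta>\<^sup>2 * V = e\<^sup>2 / 4 * (((norm W)\<^sup>2 * V) / ((norm W)\<^sup>2 * V + 1))"
        using pos by (simp add: \<eta>_def power_divide power_mult_distrib)
      also have "\<dots> \<le> e\<^sup>2 / 4 * 1"
        using pos by (intro mult_left_mono) (auto simp: divide_le_eq)
      finally show ?thesis by simp
    qed
    have "compact (\<phi> ` cball 0 R)"
      by (intro compact_continuous_image \<phi>_cont compact_cball)
    from lim[OF this] \<eta> have "\<forall>\<^sub>F n in sequentially. \<forall>u\<in>\<phi> ` cball 0 R. dist (apply_fock (g n) u) 0 < \<eta>"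
      by (rule uniform_limitD)
    then show "\<forall>\<^sub>F n in sequentially. dist (blinfun_apply W (g n)) 0 < e"
    proof eventually_elim
      case (elim n)
      define E where "E = (\<lambda>u. exp (- (cmod u)\<^sup>2) * (cmod (apply_fock (g n) u))\<^sup>2)"
      have E0: "E u \<ge> 0" for u by (simp add: E_def)
      have [measurable]: "E \<in> borel_measurable borel" unfolding E_def by measurable
      have [measurable]: "cball (0::complex) R \<in> sets borel" by simp
      have [measurable]: "\<phi> \<in> borel_measurable borel"
        by (intro borel_measurable_continuous_onI \<phi>_cont)
      have eq: "exp (- (cmod w)\<^sup>2) * (cmod (apply_fock (blinfun_apply W (g n)) w))\<^sup>2 = (m w)\<^sup>2 * E (\<phi> w)" for w
      proof -
        have "(m w)\<^sup>2 = (cmod (\<psi> w))\<^sup>2 * exp ((cmod (\<phi> w))\<^sup>2 - (cmod w)\<^sup>2)"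
          by (simp add: m_def power_mult_distrib diff_divide_distrib[symmetric] flip: exp_of_nat_mult)
        moreover have "exp ((cmod (\<phi> w))\<^sup>2 - (cmod w)\<^sup>2) * exp (- (cmod (\<phi> w))\<^sup>2) = exp (- (cmod w)\<^sup>2)"
          by (simp flip: exp_add)
        ultimately show ?thesis
          unfolding E_def acts_as_weighted_comp[OF W] \<phi>_def[symmetric]
          by (simp add: norm_mult power_mult_distrib \<phi>_def)
      qed
      have "ennreal (pi * (norm (blinfun_apply W (g n)))\<^sup>2) = (\<integral>\<^sup>+w. ennreal ((m w)\<^sup>2 * E (\<phi> w)) \<partial>lborel)"
        unfolding nn_integral_apply_fock[symmetric] eq ..
      also have "\<dots> \<le> (\<integral>\<^sup>+w. ennreal ((norm W)\<^sup>2 * \<eta>\<^sup>2) * indicator (cball 0 R) w + ennreal (\<epsilon>\<^sup>2) * ennreal (E (\<phi> w)) \<partial>lborel)"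
      proof (rule nn_integral_mono)
        fix w
        show "ennreal ((m w)\<^sup>2 * E (\<phi> w)) \<le> ennreal ((norm W)\<^sup>2 * \<eta>\<^sup>2) * indicator (cball 0 R) w + ennreal (\<epsilon>\<^sup>2) * ennreal (E (\<phi> w))"
        \<comment> \<open>On the ball the smallness comes from uniform convergence on
          \<open>\<phi>\<close> of the ball, outside it from the decay of \<open>m\<close>.\<close>
        proof (cases "cmod w \<le> R")
          case True
          have "E (\<phi> w) \<le> 1 * \<eta>\<^sup>2"
            unfolding E_def using elim True by (intro mult_mono power_mono) (auto intro: less_imp_le)
          then have "(m w)\<^sup>2 * E (\<phi> w) \<le> (norm W)\<^sup>2 * \<eta>\<^sup>2"
            using m_le[of w] m_nonneg[of w] E0 by (intro mult_mono power_mono) auto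
          then have "ennreal ((m w)\<^sup>2 * E (\<phi> w)) \<le> ennreal ((norm W)\<^sup>2 * \<eta>\<^sup>2)"
            by (rule ennreal_leI)
          then show ?thesis using True by (simp add: add_increasing2)
        next
          case False
          then have "(m w)\<^sup>2 * E (\<phi> w) \<le> \<epsilon>\<^sup>2 * E (\<phi> w)"
            using R[of w] m_nonneg[of w] E0 by (intro mult_right_mono power_mono) auto
          then have "ennreal ((m w)\<^sup>2 * E (\<phi> w)) \<le> ennreal (\<epsilon>\<^sup>2) * ennreal (E (\<phi> w))"
            using E0 by (simp add: ennreal_leI flip: ennreal_mult)
          then show ?thesis using False by simp
        qed
      qed
      also have "\<dots> = ennreal ((norm W)\<^sup>2 * \<eta>\<^sup>2) * ennreal V + ennreal (\<epsilon>\<^sup>2) * (\<integral>\<^sup>+w. ennreal (E (\<phi> w)) \<partial>lborel)"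
        by (subst nn_integral_add) (simp_all add: nn_integral_cmult V(2))
      also have "(\<integral>\<^sup>+w. ennreal (E (\<phi> w)) \<partial>lborel) = ennreal (1 / (cmod a)\<^sup>2) * ennreal (pi * (norm (g n))\<^sup>2)"
        unfolding \<phi>_def using nn_integral_lborel_complex_affine[of "\<lambda>u. ennreal (E u)" a b] a
        by (simp add: E_def nn_integral_apply_fock)
      also have "ennreal ((norm W)\<^sup>2 * \<eta>\<^sup>2) * ennreal V + ennreal (\<epsilon>\<^sup>2) * (ennreal (1 / (cmod a)\<^sup>2) * ennreal (pi * (norm (g n))\<^sup>2))
         = ennreal ((norm W)\<^sup>2 * \<eta>\<^sup>2 * V + \<epsilon>\<^sup>2 * (1 / (cmod a)\<^sup>2 * (pi * (norm (g n))\<^sup>2)))"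
        using V by (simp flip: ennreal_mult ennreal_plus)
      finally have "pi * (norm (blinfun_apply W (g n)))\<^sup>2 \<le> (norm W)\<^sup>2 * \<eta>\<^sup>2 * V + \<epsilon>\<^sup>2 * (1 / (cmod a)\<^sup>2 * (pi * (norm (g n))\<^sup>2))"
        using V by (subst (asm) ennreal_le_iff) auto
      also have "\<dots> \<le> e\<^sup>2 / 4 + \<epsilon>\<^sup>2 * (1 / (cmod a)\<^sup>2 * (pi * 2\<^sup>2))"
        using g[of n] by (intro add_mono \<eta>2 mult_left_mono power_mono) auto
      also have "\<epsilon>\<^sup>2 * (1 / (cmod a)\<^sup>2 * (pi * 2\<^sup>2)) = pi * e\<^sup>2 / 4"
        using a by (simp add: \<epsilon>_def power_divide power_mult_distrib)
      also have "e\<^sup>2 / 4 + pi * e\<^sup>2 / 4 < pi * e\<^sup>2"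
      proof -
        have "1 * e\<^sup>2 < pi * e\<^sup>2"
          using e pi_gt3 by (intro mult_strict_right_mono) auto
        moreover have "0 < e\<^sup>2" using e by simp
        ultimately show ?thesis by linarith
      qed
      finally have "(norm (blinfun_apply W (g n)))\<^sup>2 < e\<^sup>2" by simp
      then have "norm (blinfun_apply W (g n)) < e"
        by (rule power_less_imp_less_base) (use e in simp)
      then show ?case by simp
    qed
  qed
qed

lemma weighted_comp_translation_eq_weyl:
  assumes \<psi>: "\<psi> holomorphic_on UNIV" and W: "acts_as W (weighted_comp \<psi> (\<lambda>w. w + b))"
  obtains c where "W = mult_op c o\<^sub>L weyl_op (- b)"
proof -
  \<comment> \<open>This is \<open>\<psi>\<close> divided by the kernel
    \<open>normalized_kernel (- b)\<close>. Since
    \<open>(cmod (w + b))\<^sup>2 - (cmod w)\<^sup>2\<close> is twice the real part of the exponent,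
    \<open>cmod (h w)\<close> is exactly the weight, hence at most \<open>norm W\<close>.\<close>
  define h where "h = (\<lambda>w. \<psi> w * exp (w * cnj b + of_real ((cmod b)\<^sup>2 / 2)))"
  have "h holomorphic_on UNIV"
    unfolding h_def by (intro holomorphic_intros \<psi>)
  moreover have "cmod (h w) \<le> norm W" for w
  proof -
    have "(cmod (w + b))\<^sup>2 / 2 = Re (w * cnj b + of_real ((cmod b)\<^sup>2 / 2)) + (cmod w)\<^sup>2 / 2"
      by (simp add: cmod_power2 power2_sum field_simps)
    then have "cmod (h w) * exp ((cmod w)\<^sup>2 / 2) = cmod (\<psi> w) * exp ((cmod (w + b))\<^sup>2 / 2)"
      unfolding h_def norm_mult norm_exp_eq_Re by (simp only: exp_add mult.assoc)
    also have "\<dots> \<le> norm W * exp ((cmod w)\<^sup>2 / 2)"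
      by (rule weighted_comp_growth[OF W])
    finally show ?thesis by simp
  qed
  then have "bounded (range h)"
    by (auto simp: bounded_iff)
  ultimately obtain c where c: "\<And>w. h w = c"
    using Liouville_theorem by (metis constant_on_def UNIV_I)
  have \<psi>_eq: "\<psi> w = c * normalized_kernel (- b) w" for w
  proof -
    have "exp (w * cnj b + of_real ((cmod b)\<^sup>2 / 2)) * normalized_kernel (- b) w = 1"
      unfolding normalized_kernel_def exp_add[symmetric] by simp
    then show ?thesis
      using c[of w] unfolding h_def by (metis mult.assoc mult_1_right)
  qed
  have "W = mult_op c o\<^sub>L weyl_op (- b)"
    by (rule blinfun_eqI, rule fock_eqI)
       (simp add: acts_as_weighted_comp[OF W] mult_op.rep_eq apply_fock_scaleC apply_fock_weyl \<psi>_eq)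
  then show ?thesis by (rule that)
qed

theorem corollary3p11:
  fixes \<psi> \<phi> :: "complex \<Rightarrow> complex" and W :: "fock \<Rightarrow>\<^sub>L fock"
  assumes "\<psi> \<in> fock_space"
    and "\<phi> holomorphic_on UNIV"
    and "acts_as W (weighted_comp \<psi> \<phi>)"
    and "W \<in> toeplitz_algebra"
  shows "compact_operator W \<or> (\<exists>c z. W = mult_op c o\<^sub>L weyl_op z)"
proof (cases "\<exists>z. \<psi> z \<noteq> 0")
  case False
  have "blinfun_apply W F = 0" for F
    by (rule fock_eqI) (use False in \<open>simp add: acts_as_weighted_comp[OF assms(3)] zero_fock.rep_eq\<close>)
  then show ?thesis by (intro disjI1 compact_operatorI) simp
next
  case True
  have \<psi>: "\<psi> holomorphic_on UNIV" using assms(1) by (simp add: fock_space_def)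
  obtain a b where "\<And>z. \<phi> z = a * z + b"
    using affine_of_gaussian_growth[OF \<psi> assms(2) weighted_comp_growth[OF assms(3)]] True by metis
  then have \<phi>: "\<phi> = (\<lambda>z. a * z + b)" by auto
  note W = assms(3)[unfolded \<phi>]
  \<comment> \<open>Slope 0 is separated because the change of variables divides by
    \<open>(cmod a)\<^sup>2\<close>, slope 1 because the displacement \<open>(a - 1) * w + b\<close>
    is then bounded.\<close>
  consider "a = 0" | "a = 1" | "a \<noteq> 0" "a \<noteq> 1" by blast
  then show ?thesis
  proof cases
    case 1
    then show ?thesis using compact_weighted_comp_const[OF assms(1)] W by simp
  next
    case 2
    then show ?thesis using weighted_comp_translation_eq_weyl[OF \<psi>] W by (metis (no_types, lifting) mult_1 ext)
  next
    case 3
    have "filterlim (\<lambda>w. (a - 1) * w + b) at_infinity at_infinity"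
      using 3 by (intro tendsto_add_filterlim_at_infinity'[OF _ tendsto_const]
          tendsto_mult_filterlim_at_infinity[OF tendsto_const] filterlim_ident) auto
    then have "filterlim (\<lambda>w. a * w + b - w) at_infinity at_infinity"
      by (simp add: algebra_simps)
    moreover have "(weyl_commutator W \<longlongrightarrow> 0) (at 0)"
      using assms(4) toeplitz_algebra_weyl_continuous by (auto simp: weyl_continuous_def)
    ultimately show ?thesis
      using compact_weighted_comp_affine[OF W] weight_tendsto_0[OF W] 3 by blast
  qed
qed

end
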